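(* Let $(\Omega,\mathcal B)$ be a measurable space, let $\mu$ be a $\sigma$-finite signed measure on $(\Omega,\mathcal B)$ whose range $\{\mu(A):A\in\mathcal B\}$ is an interval, and let $\nu$ be a $\sigma$-finite signed measure on $(\Omega,\mathcal B)$ satisfying condition $(\mathcal L)$ with respect to $\mu$. Suppose there exist $\epsilon>0$ and $M<\infty$ such that $\left|\frac{\nu(A)}{\mu(A)}\right|<M$ whenever $A$ is an atom of $\mu$ with $\mu(A)<\epsilon$. Then $\nu=\alpha\mu$ for some $\alpha\in\mathbb R$.
   Context: A $\sigma$-finite signed measure on $(\Omega,\mathcal B)$ is a countably additive extended-real-valued set function vanishing on $\emptyset$, taking at most one of the two values $+\infty,-\infty$, whose total variation $|\mu|$ is $\sigma$-finite. An atom of a signed measure $\mu$ is an atom of $|\mu|$, i.e. a set $A\in\mathcal B$ with $|\mu|(A)>0$ such that every measurable subset $B\subset A$ has $|\mu|(B)\in\{0,|\mu|(A)\}$. A signed measure $\nu$ satisfies condition $(\mathcal L)$ with respect to $\mu$ if for all $A,B\in\mathcal B$ with $\mu(A)=\mu(B)\neq\pm\infty$ one has $\nu(A)=\nu(B)\neq\pm\infty$. *)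

theory Defs
  imports "HOL-Analysis.Analysis"
begin

definition countably_additive_signed :: "'a measure \<Rightarrow> ('a set \<Rightarrow> ereal) \<Rightarrow> bool" where
  "countably_additive_signed M mu \<longleftrightarrow>
     (\<forall>A :: nat \<Rightarrow> 'a set. range A \<subseteq> sets M \<longrightarrow> disjoint_family A \<longrightarrow>
        (\<lambda>n. \<Sum>i<n. mu (A i)) \<longlonglongrightarrow> mu (\<Union>i. A i))"

definition total_variation :: "'a measure \<Rightarrow> ('a set \<Rightarrow> ereal) \<Rightarrow> 'a set \<Rightarrow> ereal" where
  "total_variation M mu A =
     (SUP P \<in> {P. finite P \<and> P \<subseteq> sets M \<and> disjoint P \<and> \<Union>P = A}. \<Sum>B\<in>P. \<bar>mu B\<bar>)"

definition signed_measure :: "'a measure \<Rightarrow> ('a set \<Rightarrow> ereal) \<Rightarrow> bool" where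
  "signed_measure M mu \<longleftrightarrow>
     mu {} = 0 \<and>
     \<not> (\<infinity> \<in> mu ` sets M \<and> -\<infinity> \<in> mu ` sets M) \<and>
     countably_additive_signed M mu"

definition sigma_finite_signed_measure :: "'a measure \<Rightarrow> ('a set \<Rightarrow> ereal) \<Rightarrow> bool" where
  "sigma_finite_signed_measure M mu \<longleftrightarrow>
     signed_measure M mu \<and>
     (\<exists>C :: nat \<Rightarrow> 'a set. range C \<subseteq> sets M \<and> (\<Union>i. C i) = space M \<and>
        (\<forall>i. total_variation M mu (C i) < \<infinity>))"

definition signed_atom :: "'a measure \<Rightarrow> ('a set \<Rightarrow> ereal) \<Rightarrow> 'a set \<Rightarrow> bool" where
  "signed_atom M mu A \<longleftrightarrow>
     A \<in> sets M \<and> total_variation M mu A > 0 \<and>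
     (\<forall>B \<in> sets M. B \<subseteq> A \<longrightarrow>
        total_variation M mu B = 0 \<or> total_variation M mu B = total_variation M mu A)"

definition condition_L :: "'a measure \<Rightarrow> ('a set \<Rightarrow> ereal) \<Rightarrow> ('a set \<Rightarrow> ereal) \<Rightarrow> bool" where
  "condition_L M mu nu \<longleftrightarrow>
     (\<forall>A \<in> sets M. \<forall>B \<in> sets M. mu A = mu B \<and> \<bar>mu A\<bar> \<noteq> \<infinity> \<longrightarrow>
        nu A = nu B \<and> \<bar>nu A\<bar> \<noteq> \<infinity>)"

definition ereal_interval :: "ereal set \<Rightarrow> bool" where
  "ereal_interval S \<longleftrightarrow> (\<forall>x \<in> S. \<forall>z \<in> S. \<forall>y. x \<le> y \<and> y \<le> z \<longrightarrow> y \<in> S)"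

end

theory Submission
  imports Defs
begin

text \<open>Exchanging, in every set, the part inside a Hahn-negative set \<open>H\<close> replaces \<open>mu\<close> by its
  variation \<open>N\<close>, so it suffices to treat a \<open>\<sigma>\<close>-finite positive measure \<open>N\<close>; if \<open>mu\<close> takes the value
  \<open>-\<infinity>\<close>, pass to \<open>- mu\<close> first. By condition \<open>\<L>\<close> the resulting \<open>g\<close> satisfies \<open>g A = f (N A)\<close> on sets of
  finite measure, where \<open>f (x + y) = f x + f y\<close> as soon as \<open>x\<close> and \<open>y\<close> are the measures of disjoint sets.

  First \<open>f\<close> is linear near \<open>0\<close>. If there is an atomless part, \<open>f\<close> is additive and bounded there.
  Otherwise a set representing a number below \<open>\<tau>\<close> can only use atoms smaller than \<open>\<tau>\<close>; hence an initial
  interval of the domain of \<open>f\<close> is covered by finitely many overlapping intervals \<open>[y, y + s]\<close>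
  with \<open>f (y + u) = f y + f u\<close>, for arbitrarily small \<open>s\<close>. Since \<open>f t = O(t)\<close>, comparing the
  supremum and infimum of \<open>f t / t\<close> with \<open>f s / s\<close> shows that they agree.

  After subtracting the linear part \<open>f\<close> vanishes near \<open>0\<close>, and then it vanishes everywhere: an obstruction
  would produce atoms slightly larger than the last zero that carry contradictory values.\<close>

text \<open>The obstacle is that an interval as range does not make \<open>mu\<close> atomless:
  atoms of measure 1/2, 1/4, 1/8, ... already realise every number in [0,1]. Additivity of
  \<open>f\<close> is then known only for pairs that disjoint sets realise, which rules out the
  usual argument for Cauchy's equation. The source of such pairs is elementary: a set of measure r
  meets each atom larger than r in a null set, so it can be chosen disjoint from all those atoms. A
  remainder smaller than every atom already used can therefore always be added.

  The exchange inside \<open>H\<close> is the symmetric difference with \<open>H\<close>. It shifts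
  \<open>mu\<close> to \<open>mu H\<close> plus the variation, so sets of equal variation become
  sets of equal \<open>mu\<close>, and only then does condition L apply to them. The estimate
  \<open>f t = O(t)\<close> comes from the quotient bound, summed over the pieces of a set that is
  built from small atoms only. Condition L compares only sets of finite \<open>mu\<close>, so
  infinite values are recovered at the end from a countable exhaustion.\<close>

section \<open>Order principle and linearity of real functions\<close>

text \<open>The Brezis-Browder ordering principle, used here in place of the exhaustion arguments
  behind Hahn decompositions and Sierpinski's theorem. A chain that realises at each step at least
  half of the gain still possible has an upper bound beyond which no gain remains.\<close>

lemma order_principle:
  fixes le :: "'b \<Rightarrow> 'b \<Rightarrow> bool" and \<phi> :: "'b \<Rightarrow> real"
  assumes "x0 \<in> S"
    and refl: "\<And>x. x \<in> S \<Longrightarrow> le x x"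
    and trans: "\<And>x y z. \<lbrakk>x \<in> S; y \<in> S; z \<in> S; le x y; le y z\<rbrakk> \<Longrightarrow> le x z"
    and mono: "\<And>x y. \<lbrakk>x \<in> S; y \<in> S; le x y\<rbrakk> \<Longrightarrow> \<phi> x \<le> \<phi> y"
    and bound: "\<And>X::nat \<Rightarrow> 'b. \<lbrakk>\<And>n. X n \<in> S; \<And>n. le (X n) (X (Suc n))\<rbrakk>
                  \<Longrightarrow> \<exists>u\<in>S. \<forall>n. le (X n) u"
  obtains x where "x \<in> S" "le x0 x" "\<And>y. \<lbrakk>y \<in> S; le x y\<rbrakk> \<Longrightarrow> \<phi> y = \<phi> x"
proof -
  \<comment> \<open>\<open>arctan\<close> preserves the order and bounds the values, so the suprema
    below exist for every real \<open>\<phi>\<close>.\<close>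
  define \<psi> where "\<psi> x = arctan (\<phi> x)" for x
  define U where "U x = \<psi> ` {y \<in> S. le x y}" for x
  have bdd: "bdd_above (U x)" for x
    unfolding U_def \<psi>_def bdd_above_def using arctan_ubound less_imp_le by blast
  have ne: "U x \<noteq> {}" if "x \<in> S" for x
    using refl[OF that] that by (auto simp: U_def)
  have step: "\<exists>y. (y \<in> S \<and> le x0 y) \<and> (le x y \<and> (\<psi> x + Sup (U x)) / 2 \<le> \<psi> y)"
    if "x \<in> S \<and> le x0 x" for x
  proof (cases "\<psi> x = Sup (U x)")
    case True
    then show ?thesis using that refl by (intro exI[of _ x]) auto
  next
    case False
    have "\<psi> x \<le> Sup (U x)"
      using that refl bdd by (intro cSup_upper) (auto simp: U_def)
    then have less: "(\<psi> x + Sup (U x)) / 2 < Sup (U x)" using False by simp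
    have "U x \<noteq> {}" using ne that by blast
    from less_cSupE[OF less this] obtain v where v: "v \<in> U x" "(\<psi> x + Sup (U x)) / 2 < v"
      by blast
    then obtain y where y: "y \<in> S" "le x y" "v = \<psi> y" by (auto simp: U_def)
    moreover have "le x0 y" using trans[of x0 x y] that y \<open>x0 \<in> S\<close> by simp
    ultimately show ?thesis using v by (intro exI[of _ y]) simp
  qed
  have "\<exists>X. \<forall>n. (X n \<in> S \<and> le x0 (X n)) \<and>
          (le (X n) (X (Suc n)) \<and> (\<psi> (X n) + Sup (U (X n))) / 2 \<le> \<psi> (X (Suc n)))"
    by (rule dependent_nat_choice[of "\<lambda>_ x. x \<in> S \<and> le x0 x"])
       (use assms(1) refl step in auto)
  then obtain X where X: "\<And>n. X n \<in> S" "\<And>n. le x0 (X n)" "\<And>n. le (X n) (X (Suc n))"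
    "\<And>n. (\<psi> (X n) + Sup (U (X n))) / 2 \<le> \<psi> (X (Suc n))" by blast
  obtain u where u: "u \<in> S" "\<And>n. le (X n) u" using bound[of X] X by blast
  have \<psi>mono: "\<psi> x \<le> \<psi> y" if "x \<in> S" "y \<in> S" "le x y" for x y
    using mono[OF that] by (simp add: \<psi>_def arctan_le_iff)
  have "\<phi> y = \<phi> u" if y: "y \<in> S" "le u y" for y
  proof -
    \<comment> \<open>The gain still possible halves at each step, so nothing above \<open>u\<close>
      improves on \<open>u\<close>.\<close>
    have "\<psi> y - \<psi> (X n) \<le> (\<psi> y - \<psi> (X 0)) / 2 ^ n" for n
    proof (induction n)
      case (Suc n)
      have "le (X n) y" using trans X(1) u y by blast
      then have "\<psi> y \<le> Sup (U (X n))"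
        using y bdd by (intro cSup_upper) (auto simp: U_def)
      then have "\<psi> y - \<psi> (X (Suc n)) \<le> (\<psi> y - \<psi> (X n)) / 2"
        using X(4)[of n] by (simp add: field_simps)
      also have "\<dots> \<le> (\<psi> y - \<psi> (X 0)) / 2 ^ Suc n"
        using Suc by (simp add: field_simps)
      finally show ?case .
    qed simp
    moreover have "\<psi> (X n) \<le> \<psi> u" for n using \<psi>mono X(1) u by blast
    ultimately have "\<psi> y - \<psi> u \<le> (\<psi> y - \<psi> (X 0)) / 2 ^ n" for n
      by (smt (verit))
    moreover have "(\<lambda>n. (\<psi> y - \<psi> (X 0)) / 2 ^ n) \<longlonglongrightarrow> 0"
      by (intro LIMSEQ_divide_realpow_zero) auto
    ultimately have "\<psi> y - \<psi> u \<le> 0"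
      using LIMSEQ_le_const by blast
    then have "\<phi> y \<le> \<phi> u" by (simp add: \<psi>_def arctan_le_iff)
    with mono[of u y] u y show ?thesis by auto
  qed
  moreover have "le x0 u" using trans[of x0 "X 0" u] X u assms(1) by blast
  ultimately show ?thesis using that u by blast
qed

text \<open>\<open>\<phi>\<close> measures how far \<open>f\<close> falls short of the steepest
  line. Each interval \<open>[y, y + s]\<close> with \<open>y \<in> R\<close> carries a copy of
  \<open>f\<close> on \<open>[0, s]\<close>, so the defect \<open>\<phi> s\<close> is paid once per
  copy. About \<open>t / (2 * s)\<close> copies fit below a point \<open>t\<close> whose own defect
  is tiny relative to \<open>t\<close>, hence \<open>\<phi> s\<close> is small relative to
  \<open>s\<close>. The conclusion covers all small admissible \<open>s\<close>, so that one
  \<open>s\<close> can later serve both \<open>f\<close> and \<open>- f\<close>.\<close>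

lemma sup_slope_at_scale:
  fixes f :: "real \<Rightarrow> real"
  assumes "0 < x0" and bd: "\<And>t. \<lbrakk>0 \<le> t; t \<le> x0\<rbrakk> \<Longrightarrow> \<bar>f t\<bar> \<le> C * t"
    and scale: "\<And>\<delta>. 0 < \<delta> \<Longrightarrow> \<exists>s. 0 < s \<and> s < \<delta> \<and> good s"
    and good: "\<And>s. good s \<Longrightarrow> \<exists>R. finite R \<and> R \<subseteq> {0..} \<and>
        (\<forall>x\<in>{0..x0}. \<exists>y\<in>R. y \<le> x \<and> x \<le> y + s) \<and>
        (\<forall>y\<in>R. \<forall>u. 0 \<le> u \<and> u \<le> s \<and> y + u \<le> x0 \<longrightarrow> f (y + u) = f y + f u)"
    and up: "\<And>t. \<lbrakk>0 \<le> t; t \<le> x0\<rbrakk> \<Longrightarrow> f t \<le> \<beta> * t"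
    and sup: "\<And>\<delta>. 0 < \<delta> \<Longrightarrow> \<exists>t. 0 < t \<and> t \<le> x0 \<and> (\<beta> - \<delta>) * t \<le> f t"
    and "0 < \<eta>"
  obtains d where "0 < d" "\<And>s. \<lbrakk>good s; 0 < s; s < d\<rbrakk> \<Longrightarrow> (\<beta> - \<eta>) * s \<le> f s"
proof -
  define \<phi> where "\<phi> x = \<beta> * x - f x" for x
  have \<phi>0: "0 \<le> \<phi> t" if "0 \<le> t" "t \<le> x0" for t using up[OF that] by (simp add: \<phi>_def)
  have \<phi>C: "\<phi> t \<le> (\<bar>\<beta>\<bar> + C) * t" if "0 \<le> t" "t \<le> x0" for t
    using bd[OF that] abs_le_iff mult_right_mono[OF abs_ge_self[of \<beta>] that(1)]
    by (auto simp: \<phi>_def algebra_simps)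
  \<comment> \<open>Up to an error of order \<open>s\<close>, \<open>\<phi>\<close> increases: climb
    through the points of \<open>R\<close> in steps of length at most \<open>s\<close>, each of
    which adds a nonnegative value of \<open>\<phi>\<close>.\<close>
  have approx: "\<phi> x \<le> \<phi> x' + (\<bar>\<beta>\<bar> + C) * s"
    if "good s" "0 < s" "s \<le> x0" "0 \<le> x" "x \<le> x'" "x' \<le> x0" for x x' s
  proof -
    obtain R where R: "finite R" "R \<subseteq> {0..}"
      "\<And>x. \<lbrakk>0 \<le> x; x \<le> x0\<rbrakk> \<Longrightarrow> \<exists>y\<in>R. y \<le> x \<and> x \<le> y + s"
      "\<And>y u. \<lbrakk>y \<in> R; 0 \<le> u; u \<le> s; y + u \<le> x0\<rbrakk> \<Longrightarrow> f (y + u) = f y + f u"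
      using good[OF \<open>good s\<close>] by (metis atLeastAtMost_iff)
    have add: "\<phi> (y + u) = \<phi> y + \<phi> u" if "y \<in> R" "0 \<le> u" "u \<le> s" "y + u \<le> x0" for y u
      using R(4)[OF that] by (simp add: \<phi>_def algebra_simps)
    have monoR: "\<phi> y \<le> \<phi> y'" if "y \<in> R" "y' \<in> R" "y \<le> y'" "y' \<le> x0" for y y'
      using that
    proof (induction "card {r\<in>R. r < y'}" arbitrary: y' rule: less_induct)
      case less
      show ?case
      proof (cases "y = y'")
        case False
        define z where "z = Max {r\<in>R. r < y'}"
        have fin: "finite {r\<in>R. r < y'}" using R(1) by auto
        have "y \<in> {r\<in>R. r < y'}" using less.prems False by auto
        then have z: "z \<in> R" "z < y'" "y \<le> z"
          using Max_in[OF fin] Max_ge[OF fin] unfolding z_def by blast+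
        \<comment> \<open>A point strictly between \<open>z + s\<close> and \<open>y'\<close> would
          be covered from some \<open>r \<in> R\<close> below \<open>y'\<close>, but
          \<open>z\<close> is the largest such \<open>r\<close>.\<close>
        have "y' \<le> z + s"
        proof (rule ccontr)
          assume "\<not> y' \<le> z + s"
          define w where "w = (max z (z + s) + y') / 2"
          have w: "z + s < w" "w < y'" using \<open>\<not> y' \<le> z + s\<close> \<open>0 < s\<close> by (auto simp: w_def)
          moreover have "0 \<le> w" using w R(2) z \<open>0 < s\<close> by fastforce
          ultimately obtain r where r: "r \<in> R" "r \<le> w" "w \<le> r + s"
            using R(3)[of w] less.prems by auto
          then have "r \<le> z" using w(2) unfolding z_def by (intro Max_ge[OF fin]) auto
          then show False using r w by simp
        qed
        then have "\<phi> (z + (y' - z)) = \<phi> z + \<phi> (y' - z)"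
          using z less.prems by (intro add) auto
        moreover have "0 \<le> \<phi> (y' - z)" using z less.prems R(2) by (intro \<phi>0) fastforce+
        moreover have "{r \<in> R. r < z} \<subset> {r \<in> R. r < y'}" using z by auto
        then have "\<phi> y \<le> \<phi> z"
          using less.hyps[of z] z less.prems psubset_card_mono[OF fin] by auto
        ultimately show ?thesis by simp
      qed simp
    qed
    obtain y where y: "y \<in> R" "y \<le> x" "x \<le> y + s" using R(3) \<open>0 \<le> x\<close> \<open>x \<le> x'\<close> \<open>x' \<le> x0\<close> by force
    obtain y' where y': "y' \<in> R" "y' \<le> x'" "x' \<le> y' + s"
      using R(3)[of x'] \<open>0 \<le> x\<close> \<open>x \<le> x'\<close> \<open>x' \<le> x0\<close> by force
    have CC: "0 \<le> \<bar>\<beta>\<bar> + C" using bd[of x0] \<open>0 < x0\<close>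
      by (smt (verit) mult_neg_pos)
    have yx: "\<phi> (y + (x - y)) = \<phi> y + \<phi> (x - y)" using y that by (intro add) auto
    have "\<phi> (x - y) \<le> (\<bar>\<beta>\<bar> + C) * (x - y)" using y that R(2) by (intro \<phi>C) fastforce+
    also have "\<dots> \<le> (\<bar>\<beta>\<bar> + C) * s" using y CC by (intro mult_left_mono) auto
    finally have 1: "\<phi> x \<le> \<phi> y + (\<bar>\<beta>\<bar> + C) * s" using yx by simp
    have "\<phi> y \<le> \<phi> x'"
    proof (cases "y \<le> y'")
      case True
      have "\<phi> (y' + (x' - y')) = \<phi> y' + \<phi> (x' - y')" using y' that by (intro add) auto
      moreover have "0 \<le> \<phi> (x' - y')" using y' that R(2) by (intro \<phi>0) fastforce+
      ultimately show ?thesis using monoR[of y y'] True y y' that by auto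
    next
      case False
      then have "\<phi> (y + (x' - y)) = \<phi> y + \<phi> (x' - y)" using y y' that by (intro add) auto
      moreover have "0 \<le> \<phi> (x' - y)" using y that R(2) by (intro \<phi>0) fastforce+
      ultimately show ?thesis by simp
    qed
    with 1 show ?thesis by simp
  qed
  \<comment> \<open>Admissible scales are arbitrarily small, so the error term disappears.\<close>
  have mono: "\<phi> x \<le> \<phi> x'" if x: "0 \<le> x" "x \<le> x'" "x' \<le> x0" for x x'
  proof (rule field_le_epsilon)
    fix e :: real assume "0 < e"
    have "0 \<le> C" using bd[of x0] \<open>0 < x0\<close> by (smt (verit) mult_neg_pos)
    then have "0 < \<bar>\<beta>\<bar> + C + 1" by simp
    then obtain s where s: "0 < s" "s < min x0 (e / (\<bar>\<beta>\<bar> + C + 1))" "good s"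
      using scale[of "min x0 (e / (\<bar>\<beta>\<bar> + C + 1))"] \<open>0 < e\<close> \<open>0 < x0\<close> by auto
    then have "(\<bar>\<beta>\<bar> + C + 1) * s < e" using \<open>0 < \<bar>\<beta>\<bar> + C + 1\<close> by (simp add: field_simps)
    then have "(\<bar>\<beta>\<bar> + C) * s \<le> e" using s(1) by (simp add: algebra_simps)
    then show "\<phi> x \<le> \<phi> x' + e" using approx[of s x x'] s x by simp
  qed
  \<comment> \<open>Each copy costs at most \<open>2 * s\<close> of length: covering the point
    \<open>x - s\<close> yields some \<open>y \<in> R\<close> between \<open>x - 2 * s\<close> and
    \<open>x - s\<close>.\<close>
  have copies: "real k * \<phi> s \<le> \<phi> x"
    if "good s" "0 < s" "2 * real k * s \<le> x" "x \<le> x0" for s k x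
    using that(3,4)
  proof (induction k arbitrary: x)
    case 0 then show ?case using \<phi>0[of x] by simp
  next
    case (Suc k)
    obtain R where R: "finite R" "R \<subseteq> {0..}"
      "\<And>x. \<lbrakk>0 \<le> x; x \<le> x0\<rbrakk> \<Longrightarrow> \<exists>y\<in>R. y \<le> x \<and> x \<le> y + s"
      "\<And>y u. \<lbrakk>y \<in> R; 0 \<le> u; u \<le> s; y + u \<le> x0\<rbrakk> \<Longrightarrow> f (y + u) = f y + f u"
      using good[OF \<open>good s\<close>] by (metis atLeastAtMost_iff)
    have xs: "2 * real k * s + 2 * s \<le> x" using Suc.prems by (simp add: algebra_simps)
    have "0 \<le> real k * s" using \<open>0 < s\<close> by simp
    then have "s \<le> x" using xs \<open>0 < s\<close> by linarith
    then obtain y where y: "y \<in> R" "y \<le> x - s" "x - s \<le> y + s"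
      using R(3)[of "x - s"] \<open>s \<le> x\<close> Suc.prems \<open>0 < s\<close> by auto
    have "real k * \<phi> s \<le> \<phi> y" using Suc.IH[of y] y xs Suc.prems \<open>0 < s\<close> by simp
    moreover have "\<phi> (y + s) = \<phi> y + \<phi> s"
      using R(4)[of y s] y Suc.prems \<open>0 < s\<close> by (simp add: \<phi>_def algebra_simps)
    moreover have "\<phi> (y + s) \<le> \<phi> x" using mono[of "y + s" x] y R(2) \<open>0 < s\<close> Suc.prems by fastforce
    ultimately show ?case by (simp add: algebra_simps)
  qed
  \<comment> \<open>For \<open>s < t / 4\<close> the rounding in \<open>k\<close> loses at most half
    of \<open>t / (2 * s)\<close>. So at least \<open>t / (4 * s)\<close> copies share a defect of
    at most \<open>\<eta> / 4 * t\<close>, which gives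
    \<open>\<phi> s \<le> \<eta> * s\<close>.\<close>
  obtain t where t: "0 < t" "t \<le> x0" "(\<beta> - \<eta> / 4) * t \<le> f t" using sup[of "\<eta> / 4"] \<open>0 < \<eta>\<close> by auto
  have "(\<beta> - \<eta>) * s \<le> f s" if s: "good s" "0 < s" "s < t / 4" for s
  proof -
    define k where "k = nat \<lfloor>t / (2 * s)\<rfloor>"
    have "1 \<le> t / (4 * s)" using s by (simp add: field_simps)
    moreover have rk: "real k = of_int \<lfloor>t / (2 * s)\<rfloor>" using s t by (simp add: k_def)
    ultimately have k: "t / (4 * s) \<le> real k" "real k \<le> t / (2 * s)"
      by (linarith, simp)
    then have "2 * real k * s \<le> t" using s by (simp add: field_simps)
    then have "real k * \<phi> s \<le> \<phi> t" using copies s t by blast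
    moreover have "t / (4 * s) * \<phi> s \<le> real k * \<phi> s"
      using k \<phi>0[of s] s t by (intro mult_right_mono) auto
    moreover have "\<phi> t \<le> \<eta> / 4 * t" using t by (simp add: \<phi>_def algebra_simps)
    ultimately have "t / (4 * s) * \<phi> s \<le> \<eta> / 4 * t" by linarith
    then have "\<phi> s \<le> \<eta> * s" using s t by (simp add: field_simps)
    then show ?thesis by (simp add: \<phi>_def algebra_simps)
  qed
  then show ?thesis using that[of "t / 4"] t by auto
qed

text \<open>The suprema \<open>\<beta>\<close> and \<open>\<gamma>\<close> of the slopes of
  \<open>f\<close> and \<open>- f\<close> are both nearly attained at every small admissible
  \<open>s\<close>. A common \<open>s\<close> forces \<open>\<beta> + \<gamma> \<le> 0\<close>,
  which leaves only one slope.\<close>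

lemma linear_of_scaled_copies:
  fixes f :: "real \<Rightarrow> real"
  assumes "0 < x0" and bd: "\<And>t. \<lbrakk>0 \<le> t; t \<le> x0\<rbrakk> \<Longrightarrow> \<bar>f t\<bar> \<le> C * t"
    and copies: "\<And>\<delta>. 0 < \<delta> \<Longrightarrow> \<exists>s R. 0 < s \<and> s < \<delta> \<and> finite R \<and> R \<subseteq> {0..} \<and>
        (\<forall>x\<in>{0..x0}. \<exists>y\<in>R. y \<le> x \<and> x \<le> y + s) \<and>
        (\<forall>y\<in>R. \<forall>u. 0 \<le> u \<and> u \<le> s \<and> y + u \<le> x0 \<longrightarrow> f (y + u) = f y + f u)"
  obtains \<alpha> where "\<And>t. \<lbrakk>0 \<le> t; t \<le> x0\<rbrakk> \<Longrightarrow> f t = \<alpha> * t"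
proof -
  define good where "good s \<longleftrightarrow> (\<exists>R. finite R \<and> R \<subseteq> {0..} \<and>
        (\<forall>x\<in>{0..x0}. \<exists>y\<in>R. y \<le> x \<and> x \<le> y + s) \<and>
        (\<forall>y\<in>R. \<forall>u. 0 \<le> u \<and> u \<le> s \<and> y + u \<le> x0 \<longrightarrow> f (y + u) = f y + f u))" for s
  have scale: "\<exists>s. 0 < s \<and> s < \<delta> \<and> good s" if "0 < \<delta>" for \<delta>
    using copies[OF that] unfolding good_def by blast
  define S where "S h = (\<lambda>t. h t / t) ` {0<..x0}" for h :: "real \<Rightarrow> real"
  have slope: "0 \<le> t \<Longrightarrow> t \<le> x0 \<Longrightarrow> h t \<le> Sup (S h) * t"
    "0 < \<delta> \<Longrightarrow> \<exists>t. 0 < t \<and> t \<le> x0 \<and> (Sup (S h) - \<delta>) * t \<le> h t"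
    if h: "\<And>t. \<lbrakk>0 \<le> t; t \<le> x0\<rbrakk> \<Longrightarrow> \<bar>h t\<bar> \<le> C * t" for h t \<delta>
  proof -
    have bdd: "bdd_above (S h)"
    proof (rule bdd_aboveI)
      fix v assume "v \<in> S h"
      then obtain t where "0 < t" "t \<le> x0" "v = h t / t" by (auto simp: S_def)
      then show "v \<le> C" using h[of t] by (simp add: pos_divide_le_eq)
    qed
    show "h t \<le> Sup (S h) * t" if t: "0 \<le> t" "t \<le> x0"
    proof (cases "t = 0")
      case True then show ?thesis using h[of 0] t by simp
    next
      case False
      then have "h t / t \<le> Sup (S h)" using t bdd by (intro cSup_upper) (auto simp: S_def)
      then show ?thesis using False t by (simp add: field_simps)
    qed
    show "\<exists>t. 0 < t \<and> t \<le> x0 \<and> (Sup (S h) - \<delta>) * t \<le> h t" if \<delta>: "0 < \<delta>"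
    proof -
      have "S h \<noteq> {}" using \<open>0 < x0\<close> by (auto simp: S_def)
      from less_cSupE[OF _ this, of "Sup (S h) - \<delta>"] \<delta>
      obtain v where "v \<in> S h" "Sup (S h) - \<delta> < v" by auto
      then obtain t where "0 < t" "t \<le> x0" "Sup (S h) - \<delta> < h t / t" by (auto simp: S_def)
      then show ?thesis by (intro exI[of _ t]) (simp add: pos_less_divide_eq)
    qed
  qed
  define \<beta> \<gamma> where "\<beta> = Sup (S f)" and "\<gamma> = Sup (S (\<lambda>t. - f t))"
  have bd': "\<And>t. \<lbrakk>0 \<le> t; t \<le> x0\<rbrakk> \<Longrightarrow> \<bar>- f t\<bar> \<le> C * t" using bd by simp
  have goodD: "\<And>s. good s \<Longrightarrow> \<exists>R. finite R \<and> R \<subseteq> {0..} \<and>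
        (\<forall>x\<in>{0..x0}. \<exists>y\<in>R. y \<le> x \<and> x \<le> y + s) \<and>
        (\<forall>y\<in>R. \<forall>u. 0 \<le> u \<and> u \<le> s \<and> y + u \<le> x0 \<longrightarrow> f (y + u) = f y + f u)"
    by (simp only: good_def)
  have goodD': "\<And>s. good s \<Longrightarrow> \<exists>R. finite R \<and> R \<subseteq> {0..} \<and>
        (\<forall>x\<in>{0..x0}. \<exists>y\<in>R. y \<le> x \<and> x \<le> y + s) \<and>
        (\<forall>y\<in>R. \<forall>u. 0 \<le> u \<and> u \<le> s \<and> y + u \<le> x0 \<longrightarrow> - f (y + u) = - f y + - f u)"
  proof -
    have "- a = - b + - c \<longleftrightarrow> a = b + c" for a b c :: real by auto
    then show "\<And>s. good s \<Longrightarrow> \<exists>R. finite R \<and> R \<subseteq> {0..} \<and>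
        (\<forall>x\<in>{0..x0}. \<exists>y\<in>R. y \<le> x \<and> x \<le> y + s) \<and>
        (\<forall>y\<in>R. \<forall>u. 0 \<le> u \<and> u \<le> s \<and> y + u \<le> x0 \<longrightarrow> - f (y + u) = - f y + - f u)" by (simp only: good_def)
  qed
  have sup: "\<And>t. \<lbrakk>0 \<le> t; t \<le> x0\<rbrakk> \<Longrightarrow> f t \<le> \<beta> * t"
    "\<And>\<delta>. 0 < \<delta> \<Longrightarrow> \<exists>t. 0 < t \<and> t \<le> x0 \<and> (\<beta> - \<delta>) * t \<le> f t"
    unfolding \<beta>_def using slope[OF bd] by blast+
  have sup': "\<And>t. \<lbrakk>0 \<le> t; t \<le> x0\<rbrakk> \<Longrightarrow> - f t \<le> \<gamma> * t"
    "\<And>\<delta>. 0 < \<delta> \<Longrightarrow> \<exists>t. 0 < t \<and> t \<le> x0 \<and> (\<gamma> - \<delta>) * t \<le> - f t"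
    unfolding \<gamma>_def using slope[OF bd'] by blast+
  have "\<beta> + \<gamma> \<le> 0"
  proof (rule field_le_epsilon)
    fix e :: real assume "0 < e"
    then have "0 < e / 2" by simp
    obtain d where d: "0 < d" "\<And>s. \<lbrakk>good s; 0 < s; s < d\<rbrakk> \<Longrightarrow> (\<beta> - e / 2) * s \<le> f s"
      using sup_slope_at_scale[OF assms(1) bd scale goodD sup \<open>0 < e / 2\<close>] by blast
    obtain d' where d': "0 < d'" "\<And>s. \<lbrakk>good s; 0 < s; s < d'\<rbrakk> \<Longrightarrow> (\<gamma> - e / 2) * s \<le> - f s"
      using sup_slope_at_scale[OF assms(1) bd' scale goodD' sup' \<open>0 < e / 2\<close>] by blast
    obtain s where s: "0 < s" "s < min d d'" "good s" using scale[of "min d d'"] d d' by auto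
    then have "(\<beta> - e / 2) * s + (\<gamma> - e / 2) * s \<le> 0" using d(2)[of s] d'(2)[of s] by auto
    then have "(\<beta> + \<gamma> - e) * s \<le> 0" by (simp add: algebra_simps)
    then show "\<beta> + \<gamma> \<le> 0 + e" using s by (simp add: mult_le_0_iff)
  qed
  then have "f t = \<beta> * t" if "0 \<le> t" "t \<le> x0" for t
    using sup(1)[OF that] sup'(1)[OF that] mult_right_mono[of "\<beta> + \<gamma>" 0 t] that
    by (simp add: algebra_simps)
  then show ?thesis using that by blast
qed

text \<open>Cauchy's equation on a bounded interval. Multiples of \<open>t\<close> may leave
  \<open>[0, c]\<close>, so the linear function with the same value at \<open>c\<close> is
  subtracted before the Archimedean argument.\<close>

lemma additive_bounded_linear:
  fixes f :: "real \<Rightarrow> real"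
  assumes "0 < c" and add: "\<And>x y. \<lbrakk>0 \<le> x; 0 \<le> y; x + y \<le> c\<rbrakk> \<Longrightarrow> f (x + y) = f x + f y"
    and bd: "\<And>x. \<lbrakk>0 \<le> x; x \<le> c\<rbrakk> \<Longrightarrow> \<bar>f x\<bar> \<le> B" and t: "0 \<le> t" "t \<le> c"
  shows "f t = f c / c * t"
proof -
  define h where "h x = f x - f c / c * x" for x
  have hadd: "h (x + y) = h x + h y" if "0 \<le> x" "0 \<le> y" "x + y \<le> c" for x y
    using add[OF that] by (simp add: h_def algebra_simps add_divide_distrib)
  have hc: "h c = 0" using \<open>0 < c\<close> by (simp add: h_def)
  \<comment> \<open>Since \<open>h\<close> vanishes at \<open>c\<close>, it is additive modulo \<open>c\<close>, so multiples of \<open>h t\<close> are again values.\<close>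
  have mult: "\<exists>x. 0 \<le> x \<and> x \<le> c \<and> h x = real n * h t" for n
  proof (induction n)
    case 0 then show ?case using hc \<open>0 < c\<close> by (intro exI[of _ c]) auto
  next
    case (Suc n)
    then obtain x where x: "0 \<le> x" "x \<le> c" "h x = real n * h t" by blast
    show ?case
    proof (cases "x + t \<le> c")
      case True
      then show ?thesis using x t hadd[of x t] by (intro exI[of _ "x + t"]) (auto simp: algebra_simps)
    next
      \<comment> \<open>When \<open>x + t\<close> overshoots \<open>c\<close>, split
        \<open>x\<close> into \<open>c - t\<close> and the wrapped point \<open>x + t - c\<close>;
        here \<open>h (c - t) = - h t\<close>.\<close>
      case False
      have "h (c - t) + h t = 0" using hadd[of "c - t" t] hc t by simp
      moreover have "h x = h (c - t) + h (x + t - c)"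
        using hadd[of "c - t" "x + t - c"] False x t by simp
      ultimately show ?thesis using x False t
        by (intro exI[of _ "x + t - c"]) (auto simp: algebra_simps)
    qed
  qed
  have hB: "\<bar>h x\<bar> \<le> 2 * B" if "0 \<le> x" "x \<le> c" for x
  proof -
    have "\<bar>f c / c * x\<bar> = \<bar>f c\<bar> * (x / c)" using that \<open>0 < c\<close> by (simp add: abs_mult)
    also have "\<dots> \<le> \<bar>f c\<bar> * 1" using that \<open>0 < c\<close> by (intro mult_left_mono) auto
    finally show ?thesis
      using abs_triangle_ineq4[of "f x" "f c / c * x"] bd[OF that] bd[of c] \<open>0 < c\<close>
      unfolding h_def by linarith
  qed
  have "h t = 0"
  proof (rule ccontr)
    assume "h t \<noteq> 0"
    then obtain n where "2 * B < real n * \<bar>h t\<bar>" using reals_Archimedean3[of "\<bar>h t\<bar>"] by auto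
    moreover obtain x where "0 \<le> x" "x \<le> c" "h x = real n * h t" using mult by blast
    ultimately show False using hB[of x] by (simp add: abs_mult)
  qed
  then show ?thesis by (simp add: h_def)
qed

section \<open>Hahn decomposition of signed measures\<close>

lemma signed_measure_empty: "signed_measure M mu \<Longrightarrow> mu {} = 0"
  by (simp add: signed_measure_def)

lemma signed_measure_LIMSEQ:
  assumes "signed_measure M mu" "range A \<subseteq> sets M" "disjoint_family (A :: nat \<Rightarrow> _)"
  shows "(\<lambda>n. \<Sum>i<n. mu (A i)) \<longlonglongrightarrow> mu (\<Union>i. A i)"
  using assms by (simp add: signed_measure_def countably_additive_signed_def)

lemma signed_measure_Un:
  assumes mu: "signed_measure M mu" and AB: "A \<in> sets M" "B \<in> sets M" "A \<inter> B = {}"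
  shows "mu (A \<union> B) = mu A + mu B"
proof -
  define E where "E i = (if i = 0 then A else if i = 1 then B else {})" for i :: nat
  have "(\<lambda>n. \<Sum>i<n. mu (E i)) \<longlonglongrightarrow> mu (\<Union>i. E i)"
    using AB by (intro signed_measure_LIMSEQ[OF mu]) (auto simp: E_def disjoint_family_on_def)
  moreover have "(\<Union>i. E i) = A \<union> B" by (auto simp: E_def split: if_splits)
  moreover have "(\<lambda>n. \<Sum>i<n. mu (E i)) \<longlonglongrightarrow> mu A + mu B"
  proof (rule tendsto_eventually, rule eventually_sequentiallyI[of 2])
    fix n :: nat assume "2 \<le> n"
    then have "(\<Sum>i<n. mu (E i)) = (\<Sum>i\<in>{0,1}. mu (E i))"
      using signed_measure_empty[OF mu] by (intro sum.mono_neutral_right) (auto simp: E_def)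
    then show "(\<Sum>i<n. mu (E i)) = mu A + mu B" by (simp add: E_def)
  qed
  ultimately show ?thesis using LIMSEQ_unique by metis
qed

lemma signed_measure_Diff:
  assumes "signed_measure M mu" "A \<in> sets M" "B \<in> sets M" "B \<subseteq> A"
  shows "mu A = mu B + mu (A - B)"
  using signed_measure_Un[of M mu B "A - B"] assms by (auto simp: Un_absorb1)

text \<open>In \<open>ereal\<close> a sum with an infinite summand is infinite whatever the other
  summand is, so an infinite part would make \<open>mu A\<close> infinite.\<close>

lemma signed_measure_finite_subset:
  assumes "signed_measure M mu" "A \<in> sets M" "B \<in> sets M" "B \<subseteq> A" "\<bar>mu A\<bar> \<noteq> \<infinity>"
  shows "\<bar>mu B\<bar> \<noteq> \<infinity>"
  using signed_measure_Diff[OF assms(1-4)] assms(5) by (cases "mu B"; cases "mu (A - B)") auto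

lemma signed_measure_real_Diff:
  assumes "signed_measure M mu" "A \<in> sets M" "B \<in> sets M" "B \<subseteq> A" "\<bar>mu A\<bar> \<noteq> \<infinity>"
  shows "real_of_ereal (mu A) = real_of_ereal (mu B) + real_of_ereal (mu (A - B))"
  using signed_measure_Diff[OF assms(1-4)] signed_measure_finite_subset[OF assms]
    signed_measure_finite_subset[OF assms(1,2) _ _ assms(5), of "A - B"] assms
  by (cases "mu B"; cases "mu (A - B)") auto

lemma signed_measure_sums:
  assumes mu: "signed_measure M mu" and A: "range A \<subseteq> sets M" "disjoint_family (A :: nat \<Rightarrow> _)"
    and fin: "\<bar>mu (\<Union>i. A i)\<bar> \<noteq> \<infinity>"
  shows "(\<lambda>i. real_of_ereal (mu (A i))) sums real_of_ereal (mu (\<Union>i. A i))"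
proof -
  have "\<bar>mu (A i)\<bar> \<noteq> \<infinity>" for i
    using A by (intro signed_measure_finite_subset[OF mu _ _ _ fin]) auto
  then have "ereal (\<Sum>i<n. real_of_ereal (mu (A i))) = (\<Sum>i<n. mu (A i))" for n
    by (auto simp: ereal_real simp flip: sum_ereal)
  then have "(\<lambda>n. ereal (\<Sum>i<n. real_of_ereal (mu (A i)))) \<longlonglongrightarrow> ereal (real_of_ereal (mu (\<Union>i. A i)))"
    using signed_measure_LIMSEQ[OF mu A] fin by (simp add: ereal_real)
  then show ?thesis by (simp add: sums_def)
qed

lemma signed_measure_uminus:
  assumes mu: "signed_measure M mu"
  shows "signed_measure M (\<lambda>A. - mu A)"
  unfolding signed_measure_def countably_additive_signed_def
proof (intro conjI allI impI)
  show "- mu {} = 0" using mu by (simp add: signed_measure_def)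
  show "\<not> (\<infinity> \<in> (\<lambda>A. - mu A) ` sets M \<and> - \<infinity> \<in> (\<lambda>A. - mu A) ` sets M)"
  proof
    assume "\<infinity> \<in> (\<lambda>A. - mu A) ` sets M \<and> - \<infinity> \<in> (\<lambda>A. - mu A) ` sets M"
    then obtain A B where "A \<in> sets M" "\<infinity> = - mu A" "B \<in> sets M" "- \<infinity> = - mu B" by blast
    then have "\<infinity> \<in> mu ` sets M" "- \<infinity> \<in> mu ` sets M"
      by (metis ereal_uminus_uminus image_eqI)+
    then show False using mu by (simp add: signed_measure_def)
  qed
  fix A :: "nat \<Rightarrow> _" assume A: "range A \<subseteq> sets M" "disjoint_family A"
  \<comment> \<open>Negation does not distribute over the \<open>ereal\<close> sum of \<infinity>
    and -\<infinity>; this case is excluded because \<open>mu\<close> takes at most one of the two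
    values.\<close>
  have uminus_add: "- (x + y) = - x + - y" if "x \<in> mu ` sets M" "y \<in> mu ` sets M" for x y
  proof -
    have "\<not> (\<infinity> \<in> mu ` sets M \<and> - \<infinity> \<in> mu ` sets M)"
      using mu by (simp add: signed_measure_def)
    then show ?thesis using that by (cases x; cases y) simp_all
  qed
  \<comment> \<open>The two identities are proved together, since partial sums must be recognised as
    values of \<open>mu\<close> before \<open>uminus_add\<close> applies to them.\<close>
  have part: "mu (\<Union>i<n. A i) = (\<Sum>i<n. mu (A i)) \<and> - mu (\<Union>i<n. A i) = (\<Sum>i<n. - mu (A i))" for n
  proof (induction n)
    case 0 then show ?case using mu by (simp add: signed_measure_def)
  next
    case (Suc n)
    have U: "(\<Union>i<n. A i) \<in> sets M" using A by auto
    have "A i \<inter> A n = {}" if "i < n" for i using disjoint_family_onD[OF A(2), of i n] that by auto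
    then have "(\<Union>i<n. A i) \<inter> A n = {}" by auto
    moreover have "(\<Union>i<Suc n. A i) = (\<Union>i<n. A i) \<union> A n" by (auto simp: lessThan_Suc)
    ultimately have "mu (\<Union>i<Suc n. A i) = mu (\<Union>i<n. A i) + mu (A n)"
      using signed_measure_Un[OF mu U, of "A n"] A(1) by auto
    moreover have "- (mu (\<Union>i<n. A i) + mu (A n)) = - mu (\<Union>i<n. A i) + - mu (A n)"
      using A(1) U by (intro uminus_add) auto
    moreover note Suc[THEN conjunct1, symmetric] Suc[THEN conjunct2, symmetric]
    ultimately show ?case by (simp only: sum.lessThan_Suc)
  qed
  have "(\<lambda>n. - (\<Sum>i<n. mu (A i))) \<longlonglongrightarrow> - mu (\<Union>i. A i)"
    using signed_measure_LIMSEQ[OF mu A] by (intro tendsto_intros)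
  moreover have "(\<Sum>i<n. - mu (A i)) = - (\<Sum>i<n. mu (A i))" for n
    using trans[OF part[of n, THEN conjunct2, symmetric]
        arg_cong[OF part[of n, THEN conjunct1], of uminus]] .
  ultimately show "(\<lambda>n. \<Sum>i<n. - mu (A i)) \<longlonglongrightarrow> - mu (\<Union>i. A i)" by (simp only:)
qed

text \<open>Provides the upper bounds for the order in \<open>negative_subset\<close>. The union
  minus \<open>X n\<close> is the disjoint union of the later increments, whose series has
  nonnegative terms.\<close>

lemma signed_measure_incseq_nonneg:
  assumes mu: "signed_measure M mu" and X: "range X \<subseteq> sets M" "\<And>n. X n \<subseteq> X (Suc n)"
    and fin: "\<bar>mu (\<Union>i. X i)\<bar> \<noteq> \<infinity>" and ge: "\<And>n. 0 \<le> real_of_ereal (mu (X (Suc n) - X n))"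
  shows "0 \<le> real_of_ereal (mu ((\<Union>i. X i) - X n))"
proof -
  have le: "X m \<subseteq> X k" if "m \<le> k" for m k using lift_Suc_mono_le[of X] X(2) that by blast
  define E where "E i = X (Suc (n + i)) - X (n + i)" for i
  have UE: "(\<Union>i. E i) = (\<Union>i. X i) - X n"
  proof (intro equalityI subsetI)
    fix x assume "x \<in> (\<Union>i. X i) - X n"
    then obtain k where k: "x \<in> X k" "x \<notin> X n" by auto
    define j where "j = (LEAST j. x \<in> X (n + j))"
    have "x \<in> X (n + k)" using k le[of k "n + k"] by auto
    then have j: "x \<in> X (n + j)" unfolding j_def by (rule LeastI)
    then have "j \<noteq> 0" using k by (metis add.right_neutral)
    then obtain i where i: "j = Suc i" by (cases j) auto
    then have "x \<notin> X (n + i)" using not_less_Least[of i "\<lambda>j. x \<in> X (n + j)"] by (simp add: j_def)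
    then show "x \<in> (\<Union>i. E i)" using j i by (auto simp: E_def)
  next
    fix x assume "x \<in> (\<Union>i. E i)"
    then obtain i where "x \<in> X (Suc (n + i))" "x \<notin> X (n + i)" by (auto simp: E_def)
    then show "x \<in> (\<Union>i. X i) - X n" using le[of n "n + i"] by auto
  qed
  have "disjoint_family E"
    unfolding disjoint_family_on_def
  proof (intro ballI impI)
    fix i j :: nat assume "i \<noteq> j"
    then consider "Suc (n + i) \<le> n + j" | "Suc (n + j) \<le> n + i" by linarith
    then show "E i \<inter> E j = {}"
    proof cases
      case 1
      then show ?thesis using le[OF 1] by (auto simp: E_def)
    next
      case 2
      then show ?thesis using le[OF 2] by (auto simp: E_def)
    qed
  qed
  moreover have "range E \<subseteq> sets M" using X by (auto simp: E_def)
  moreover have "\<bar>mu (\<Union>i. E i)\<bar> \<noteq> \<infinity>"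
    unfolding UE using X by (intro signed_measure_finite_subset[OF mu _ _ _ fin]) auto
  ultimately have "(\<lambda>i. real_of_ereal (mu (E i))) sums real_of_ereal (mu (\<Union>i. E i))"
    by (intro signed_measure_sums[OF mu]) auto
  then show ?thesis
    unfolding UE using ge suminf_nonneg[of "\<lambda>i. real_of_ereal (mu (E i))"]
    by (auto simp: sums_iff E_def)
qed

text \<open>Remove from \<open>A\<close> a set whose value cannot be raised by adjoining sets of
  nonnegative measure. The removed set has nonnegative measure, so the value of the rest is at most
  \<open>mu A\<close>; a subset of the rest with positive measure could still have been
  removed.\<close>

lemma negative_subset:
  assumes mu: "signed_measure M mu" and A: "A \<in> sets M" "\<bar>mu A\<bar> \<noteq> \<infinity>"
  obtains B where "B \<in> sets M" "B \<subseteq> A" "mu B \<le> mu A"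
    "\<And>Z. \<lbrakk>Z \<in> sets M; Z \<subseteq> B\<rbrakk> \<Longrightarrow> mu Z \<le> 0"
proof -
  define m where "m X = real_of_ereal (mu X)" for X
  define S where "S = {X \<in> sets M. X \<subseteq> A}"
  define le where "le X Y \<longleftrightarrow> X \<subseteq> Y \<and> 0 \<le> m (Y - X)" for X Y
  have fin: "\<bar>mu X\<bar> \<noteq> \<infinity>" if "X \<in> S" for X
    using signed_measure_finite_subset[OF mu A(1) _ _ A(2)] that by (auto simp: S_def)
  have diff: "m Y = m X + m (Y - X)" if "X \<in> S" "Y \<in> S" "X \<subseteq> Y" for X Y
    using signed_measure_real_Diff[OF mu] that fin by (auto simp: S_def m_def)
  have DS: "Y - X \<in> S" if "X \<in> S" "Y \<in> S" for X Y using that by (auto simp: S_def)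
  have m0: "m {} = 0" using signed_measure_empty[OF mu] by (simp add: m_def)
  obtain X where X: "X \<in> S" "le {} X" "\<And>Y. \<lbrakk>Y \<in> S; le X Y\<rbrakk> \<Longrightarrow> m Y = m X"
  proof (rule order_principle[of "{}" S le m])
    show "{} \<in> S" by (simp add: S_def)
    show "le X X" for X by (simp add: le_def m0)
    show "le X Z" if "X \<in> S" "Y \<in> S" "Z \<in> S" "le X Y" "le Y Z" for X Y Z
    proof -
      have "X \<subseteq> Z" using that by (auto simp: le_def)
      then show ?thesis
        using diff[OF that(1,2)] diff[OF that(1,3)] diff[OF that(2,3)] that(4,5)
        by (simp add: le_def)
    qed
    show "m X \<le> m Y" if "X \<in> S" "Y \<in> S" "le X Y" for X Y
      using diff[OF that(1,2)] that by (auto simp: le_def)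
    fix X :: "nat \<Rightarrow> _" assume X: "\<And>n. X n \<in> S" "\<And>n. le (X n) (X (Suc n))"
    have U: "(\<Union>i. X i) \<in> S" using X(1) by (auto simp: S_def)
    have "0 \<le> m ((\<Union>i. X i) - X n)" for n
      unfolding m_def using X fin[OF U]
      by (intro signed_measure_incseq_nonneg[OF mu]) (auto simp: S_def le_def m_def)
    then show "\<exists>u\<in>S. \<forall>n. le (X n) u" using U by (intro bexI[of _ "\<Union>i. X i"]) (auto simp: le_def)
  qed blast
  have AS: "A \<in> S" using A by (simp add: S_def)
  have "m (A - X) \<le> m A" using diff[OF X(1) AS] X(1,2) by (simp add: le_def S_def)
  moreover have "mu Z \<le> 0" if Z: "Z \<in> sets M" "Z \<subseteq> A - X" for Z
  proof (rule ccontr)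
    assume "\<not> mu Z \<le> 0"
    have ZS: "Z \<in> S" using Z by (auto simp: S_def)
    have pos: "0 < m Z" using \<open>\<not> mu Z \<le> 0\<close> fin[OF ZS] unfolding m_def by (cases "mu Z") auto
    have "X \<union> Z \<in> S" using X(1) ZS by (auto simp: S_def)
    moreover have "X \<union> Z - X = Z" using Z by auto
    ultimately show False
      using X(3)[of "X \<union> Z"] diff[of X "X \<union> Z"] X(1) pos by (auto simp: le_def)
  qed
  moreover have "mu (A - X) \<le> mu A"
    using calculation(1) fin[OF AS] fin[OF DS[OF X(1) AS]] unfolding m_def
    by (cases "mu A"; cases "mu (A - X)") auto
  moreover have "A - X \<in> sets M" using X(1) A by (auto simp: S_def)
  ultimately show ?thesis by (intro that[of "A - X"]) auto
qed

text \<open>\<open>H\<close> maximises \<open>- mu\<close> among the negative sets. A set of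
  negative measure outside \<open>H\<close> contains a negative set by
  \<open>negative_subset\<close>, and adjoining that would beat \<open>H\<close>. Excluding the
  value -\<infinity> makes \<open>mu\<close> finite on negative sets, so that \<open>\<phi>\<close>
  is meaningful there.\<close>

lemma Hahn_decomposition_signed:
  assumes mu: "signed_measure M mu" and no_MInf: "- \<infinity> \<notin> mu ` sets M"
  obtains H where "H \<in> sets M" "\<And>B. \<lbrakk>B \<in> sets M; B \<subseteq> H\<rbrakk> \<Longrightarrow> mu B \<le> 0"
    "\<And>B. \<lbrakk>B \<in> sets M; B \<inter> H = {}\<rbrakk> \<Longrightarrow> 0 \<le> mu B"
proof -
  define neg where "neg X \<longleftrightarrow> (\<forall>B\<in>sets M. B \<subseteq> X \<longrightarrow> mu B \<le> 0)" for X
  define S where "S = {X \<in> sets M. neg X}"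
  define \<phi> where "\<phi> X = - real_of_ereal (mu X)" for X
  have fin: "\<bar>mu X\<bar> \<noteq> \<infinity>" if "X \<in> S" for X
    using that no_MInf unfolding S_def neg_def by (cases "mu X") (auto simp: image_iff)
  have le0: "real_of_ereal (mu X) \<le> 0" if "X \<in> S" for X
    using that fin[OF that] unfolding S_def neg_def by (cases "mu X") auto
  have DS: "Y - X \<in> S" if "X \<in> S" "Y \<in> S" for X Y using that by (auto simp: S_def neg_def)
  have mono: "\<phi> X \<le> \<phi> Y" if "X \<in> S" "Y \<in> S" "X \<subseteq> Y" for X Y
    using signed_measure_real_Diff[OF mu, of Y X] that fin[of Y] le0[OF DS[of X Y]]
    by (auto simp: S_def \<phi>_def)
  have UN: "(\<Union>i. X i) \<in> S" if X: "\<And>n::nat. X n \<in> S" for X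
  proof -
    have "mu B \<le> 0" if B: "B \<in> sets M" "B \<subseteq> (\<Union>i. X i)" for B
    proof -
      \<comment> \<open>Disjointing keeps each piece of \<open>B\<close> inside a single
        \<open>X i\<close>, so all partial sums are nonpositive.\<close>
      define E where "E i = disjointed X i \<inter> B" for i
      have rX: "range X \<subseteq> sets M" using X by (auto simp: S_def)
      have E: "range E \<subseteq> sets M" using sets.range_disjointed_sets[OF rX] B by (auto simp: E_def)
      have "disjoint_family E"
        using disjoint_family_on_bisimulation[OF disjoint_family_disjointed[of X], of E]
        by (auto simp: E_def)
      moreover have "(\<Union>i. E i) = (\<Union>i. disjointed X i) \<inter> B" by (simp add: E_def)
      then have "(\<Union>i. E i) = B" using B(2) by (simp add: UN_disjointed_eq Int_absorb1)
      ultimately have "(\<lambda>n. \<Sum>i<n. mu (E i)) \<longlonglongrightarrow> mu B"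
        using signed_measure_LIMSEQ[OF mu E] by simp
      moreover have "mu (E i) \<le> 0" for i
      proof -
        have "E i \<in> sets M" "E i \<subseteq> X i" using E disjointed_subset[of X i] by (auto simp: E_def)
        then show ?thesis using X[of i] by (simp add: S_def neg_def)
      qed
      then have "(\<Sum>i<n. mu (E i)) \<le> 0" for n by (intro sum_nonpos) auto
      ultimately show ?thesis by (intro LIMSEQ_le_const2) auto
    qed
    then show ?thesis using X by (auto simp: S_def neg_def)
  qed
  obtain H where H: "H \<in> S" "\<And>Y. \<lbrakk>Y \<in> S; H \<subseteq> Y\<rbrakk> \<Longrightarrow> \<phi> Y = \<phi> H"
  proof (rule order_principle[of "{}" S "(\<subseteq>)" \<phi>])
    show "{} \<in> S" using signed_measure_empty[OF mu] by (auto simp: S_def neg_def)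
    show "\<exists>u\<in>S. \<forall>n. X n \<subseteq> u" if "\<And>n::nat. X n \<in> S" for X
      using UN[OF that] by (intro bexI[of _ "\<Union>i. X i"]) auto
  qed (fact subset_refl subset_trans mono | assumption | blast intro: mono)+
  have "0 \<le> mu A" if A: "A \<in> sets M" "A \<inter> H = {}" for A
  proof (rule ccontr)
    assume "\<not> 0 \<le> mu A"
    then have "mu A < 0" "\<bar>mu A\<bar> \<noteq> \<infinity>" using no_MInf A by (cases "mu A"; force)+
    then obtain B where B: "B \<in> sets M" "B \<subseteq> A" "mu B \<le> mu A" "neg B"
      using negative_subset[OF mu A(1)] unfolding neg_def by metis
    have dis: "H \<inter> B = {}" using B A by auto
    have BS: "B \<in> S" using B by (simp add: S_def)
    have HB: "H \<union> B \<in> S"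
    proof -
      have "mu Z \<le> 0" if Z: "Z \<in> sets M" "Z \<subseteq> H \<union> B" for Z
      proof -
        have "Z = (Z \<inter> H) \<union> (Z \<inter> B)" using Z by auto
        then have "mu Z = mu (Z \<inter> H) + mu (Z \<inter> B)"
          using signed_measure_Un[OF mu, of "Z \<inter> H" "Z \<inter> B"] Z B H(1) dis
          by (auto simp: S_def)
        moreover have "mu (Z \<inter> H) \<le> 0" "mu (Z \<inter> B) \<le> 0"
          using Z B H(1) by (auto simp: S_def neg_def)
        ultimately show ?thesis by (simp add: add_nonpos_nonpos)
      qed
      then show ?thesis using H(1) B by (auto simp: S_def neg_def)
    qed
    have "H \<union> B - H = B" using dis by auto
    then have "\<phi> (H \<union> B) = \<phi> H + \<phi> B"
      using signed_measure_real_Diff[OF mu, of "H \<union> B" H] fin[OF HB] HB H(1)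
      by (auto simp: S_def \<phi>_def)
    moreover have "0 < \<phi> B" using fin[OF BS] B(3) \<open>mu A < 0\<close> unfolding \<phi>_def
      by (cases "mu B"; cases "mu A") auto
    ultimately show False using H(2)[OF HB] by auto
  qed
  then show ?thesis using that[of H] H(1) by (auto simp: S_def neg_def)
qed

section \<open>Atoms of \<sigma>-finite measures\<close>

text \<open>The notion for the positive measure that replaces \<open>mu\<close>;
  \<open>signed_atom_iff\<close> identifies it with \<open>signed_atom\<close>.\<close>

definition measure_atom :: "'a measure \<Rightarrow> 'a set \<Rightarrow> bool" where
  "measure_atom N A \<longleftrightarrow> A \<in> sets N \<and> emeasure N A > 0 \<and>
     (\<forall>B\<in>sets N. B \<subseteq> A \<longrightarrow> emeasure N B = 0 \<or> emeasure N B = emeasure N A)"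

lemma measure_Un_fmeasurable:
  "\<lbrakk>A \<in> fmeasurable N; B \<in> fmeasurable N; A \<inter> B = {}\<rbrakk> \<Longrightarrow>
    measure N (A \<union> B) = measure N A + measure N B"
  by (rule measure_Union) (auto simp: fmeasurable_def)

context sigma_finite_measure
begin

lemma exists_fmeasurable_subset:
  assumes "A \<in> sets M" "emeasure M A > 0"
  obtains B where "B \<in> fmeasurable M" "B \<subseteq> A" "emeasure M B > 0"
proof -
  obtain C :: "nat \<Rightarrow> 'a set" where C: "range C \<subseteq> sets M" "(\<Union>i. C i) = space M"
    "\<And>i. emeasure M (C i) \<noteq> \<infinity>" by (metis sigma_finite)
  have "\<exists>i. emeasure M (A \<inter> C i) > 0"
  proof (rule ccontr)
    assume "\<not> ?thesis"
    then have "A \<inter> C i \<in> null_sets M" for i using assms(1) C(1) by (auto simp: null_sets_def)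
    then have "(\<Union>i. A \<inter> C i) \<in> null_sets M" by (rule null_sets_UN)
    moreover have "(\<Union>i. A \<inter> C i) = A" using C(2) sets.sets_into_space[OF assms(1)] by auto
    ultimately show False using assms(2) by auto
  qed
  then obtain i where i: "emeasure M (A \<inter> C i) > 0" by blast
  have "C i \<in> fmeasurable M" using C by (auto simp: fmeasurable_def less_top)
  then have "A \<inter> C i \<in> fmeasurable M" using assms(1) fmeasurable_Int_fmeasurable[of "C i" M A] by (simp add: Int_commute)
  then show ?thesis using that i by blast
qed

text \<open>By \<sigma>-finiteness an atom contains a set of finite positive measure, and such a
  subset has the measure of the whole atom.\<close>

lemma atom_fmeasurable:
  assumes "measure_atom M A"
  shows "A \<in> fmeasurable M"
proof -
  have A: "A \<in> sets M" "emeasure M A > 0" using assms by (auto simp: measure_atom_def)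
  obtain B where B: "B \<in> fmeasurable M" "B \<subseteq> A" "emeasure M B > 0"
    using exists_fmeasurable_subset[OF A] by blast
  then have "emeasure M A = emeasure M B" 
    using assms fmeasurableD[OF B(1)] unfolding measure_atom_def by fastforce
  then show ?thesis using A B by (auto simp: fmeasurable_def)
qed

lemma atom_measure_pos:
  assumes "measure_atom M A"
  shows "measure M A > 0"
proof -
  have "0 < emeasure M A" using assms by (simp add: measure_atom_def)
  then show ?thesis by (simp add: emeasure_eq_measure2[OF atom_fmeasurable[OF assms]])
qed

lemma atom_Int_cases:
  assumes "measure_atom M A" "B \<in> sets M"
  shows "measure M (B \<inter> A) = 0 \<or> measure M (B \<inter> A) = measure M A"
proof -
  have "B \<inter> A \<in> sets M" using assms by (auto simp: measure_atom_def)
  then have "emeasure M (B \<inter> A) = 0 \<or> emeasure M (B \<inter> A) = emeasure M A"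
    using assms unfolding measure_atom_def by blast
  then show ?thesis by (auto simp: measure_def)
qed

text \<open>On each \<open>C i\<close> of finite measure the numbers
  \<open>measure M (A \<inter> C i)\<close> are summable over the disjoint family, so only countably
  many are nonzero. Every member of \<open>F\<close> has a nonzero number for some
  \<open>i\<close>.\<close>

lemma countable_disjoint_positive:
  assumes F: "disjoint F" "\<And>A. A \<in> F \<Longrightarrow> A \<in> sets M" "\<And>A. A \<in> F \<Longrightarrow> emeasure M A > 0"
  shows "countable F"
proof -
  obtain C :: "nat \<Rightarrow> 'a set" where C: "range C \<subseteq> sets M" "(\<Union>i. C i) = space M"
    "\<And>i. emeasure M (C i) \<noteq> \<infinity>" by (metis sigma_finite)
  have cnt: "countable {A \<in> F. measure M (A \<inter> C i) \<noteq> 0}" for i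
  proof (rule summable_countable_real, rule nonneg_bdd_above_summable_on)
    have Ci: "C i \<in> fmeasurable M" using C by (auto simp: fmeasurable_def less_top)
    show "bdd_above (sum (\<lambda>A. measure M (A \<inter> C i)) ` {X. X \<subseteq> F \<and> finite X})"
    proof (rule bdd_aboveI2)
      fix X assume "X \<in> {X. X \<subseteq> F \<and> finite X}"
      then have X: "X \<subseteq> F" "finite X" by auto
      have AC: "A \<inter> C i \<in> fmeasurable M" if "A \<in> F" for A
        using F(2)[OF that] fmeasurable_Int_fmeasurable[OF Ci, of A] by (simp add: Int_commute)
      have dis: "disjoint_family_on (\<lambda>A. A \<inter> C i) X"
        using X(1) F(1) unfolding disjoint_family_on_def disjoint_def by blast
      have "(\<Sum>A\<in>X. measure M (A \<inter> C i)) = measure M (\<Union>A\<in>X. A \<inter> C i)"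
        using X AC dis by (intro measure_finite_Union[symmetric]) (auto dest!: AC simp: fmeasurable_def)
      also have "\<dots> \<le> measure M (C i)"
        using X AC by (intro measure_mono_fmeasurable[OF _ _ Ci] sets.finite_UN) auto
      finally show "(\<Sum>A\<in>X. measure M (A \<inter> C i)) \<le> measure M (C i)" .
    qed
  qed auto
  have "F \<subseteq> (\<Union>i. {A \<in> F. measure M (A \<inter> C i) \<noteq> 0})"
  proof
    fix A assume A: "A \<in> F"
    have "\<exists>i. measure M (A \<inter> C i) \<noteq> 0"
    proof (rule ccontr)
      assume 0: "\<nexists>i. measure M (A \<inter> C i) \<noteq> 0"
      have "A \<inter> C i \<in> null_sets M" for i
      proof -
        have "C i \<in> fmeasurable M" using C by (auto simp: fmeasurable_def less_top)
        then have "A \<inter> C i \<in> fmeasurable M" using F(2)[OF A] fmeasurable_Int_fmeasurable[of "C i" M A] by (simp add: Int_commute)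
        then show ?thesis using 0 emeasure_eq_measure2[of "A \<inter> C i" M] by (auto simp: null_sets_def)
      qed
      then have "(\<Union>i. A \<inter> C i) \<in> null_sets M" by (rule null_sets_UN)
      moreover have "(\<Union>i. A \<inter> C i) = A" using C(2) sets.sets_into_space[OF F(2)[OF A]] by auto
      ultimately show False using F(3)[OF A] by auto
    qed
    then show "A \<in> (\<Union>i. {A \<in> F. measure M (A \<inter> C i) \<noteq> 0})" using A by auto
  qed
  moreover have "countable (\<Union>i. {A \<in> F. measure M (A \<inter> C i) \<noteq> 0})"
    using cnt by (intro countable_UN countableI_type)
  ultimately show ?thesis by (rule countable_subset)
qed

text \<open>Zorn's lemma gives a family that cannot be enlarged, so no atom fits into the complement
  of its union. Countability later makes that complement measurable and permits countable sums over
  the atoms.\<close>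

lemma maximal_disjoint_atoms:
  obtains F where "countable F" "disjoint F" "\<And>A. A \<in> F \<Longrightarrow> measure_atom M A"
    "\<And>B. B \<subseteq> space M - \<Union>F \<Longrightarrow> \<not> measure_atom M B"
proof -
  define \<A> where "\<A> = {F. (\<forall>A\<in>F. measure_atom M A) \<and> disjoint F}"
  have "\<exists>F\<in>\<A>. \<forall>X\<in>\<A>. F \<subseteq> X \<longrightarrow> X = F"
  proof (rule subset_Zorn')
    fix C assume C: "subset.chain \<A> C"
    then have sub: "C \<subseteq> \<A>" by (simp add: subset_chain_def)
    have "disjoint (\<Union>C)"
    proof (rule disjointI)
      fix A B assume AB: "A \<in> \<Union>C" "B \<in> \<Union>C" "A \<noteq> B"
      then obtain X Y where XY: "A \<in> X" "X \<in> C" "B \<in> Y" "Y \<in> C" by blast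
      then have "X \<subseteq> Y \<or> Y \<subseteq> X" using C by (auto simp: subset_chain_def)
      then show "A \<inter> B = {}"
      proof
        assume "X \<subseteq> Y"
        then show ?thesis using XY sub AB disjointD[of Y A B] by (auto simp: \<A>_def)
      next
        assume "Y \<subseteq> X"
        then show ?thesis using XY sub AB disjointD[of X A B] by (auto simp: \<A>_def)
      qed
    qed
    then show "\<Union>C \<in> \<A>" using sub by (auto simp: \<A>_def)
  qed
  then obtain F where F: "F \<in> \<A>" "\<And>X. X \<in> \<A> \<Longrightarrow> F \<subseteq> X \<Longrightarrow> X = F" by blast
  show ?thesis
  proof (rule that)
    show "countable F" using F(1)
      by (intro countable_disjoint_positive) (auto simp: \<A>_def measure_atom_def)
    fix B assume B: "B \<subseteq> space M - \<Union>F"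
    show "\<not> measure_atom M B"
    proof
      assume at: "measure_atom M B"
      \<comment> \<open>A nonempty set outside the union of \<open>F\<close> is not yet a member of
        \<open>F\<close>, so inserting it enlarges the family.\<close>
      have "B \<noteq> {}" using at by (auto simp: measure_atom_def)
      then have "B \<notin> F" using B by blast
      moreover have "insert B F \<in> \<A>"
        using F(1) at B unfolding \<A>_def disjoint_def by blast
      ultimately show False using F(2)[of "insert B F"] by blast
    qed
  qed (use F(1) in \<open>auto simp: \<A>_def\<close>)
qed

text \<open>A set of finite positive measure that is not an atom splits into two parts of positive
  measure, one of which has at most half of it. Iterate inside \<open>A0\<close>.\<close>

lemma atomless_small_subset:
  assumes D: "\<And>B. B \<subseteq> D \<Longrightarrow> \<not> measure_atom M B"
    and A: "A \<in> sets M" "A \<subseteq> D" "emeasure M A > 0" and "0 < e"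
  obtains B where "B \<in> fmeasurable M" "B \<subseteq> A" "0 < measure M B" "measure M B \<le> e"
proof -
  obtain A0 where A0: "A0 \<in> fmeasurable M" "A0 \<subseteq> A" "emeasure M A0 > 0"
    using exists_fmeasurable_subset[OF A(1,3)] by blast
  have half: "\<exists>B. B \<in> fmeasurable M \<and> B \<subseteq> A0 \<and> 0 < measure M B \<and>
      measure M B \<le> measure M A0 / 2 ^ n" for n
  proof (induction n)
    case 0
    then show ?case using A0 by (intro exI[of _ A0]) (auto simp: emeasure_eq_measure2)
  next
    case (Suc n)
    then obtain B where B: "B \<in> fmeasurable M" "B \<subseteq> A0" "0 < measure M B"
      "measure M B \<le> measure M A0 / 2 ^ n" by blast
    have "\<not> measure_atom M B" using D A0(2) A(2) B(2) by blast
    then obtain C where C: "C \<in> sets M" "C \<subseteq> B" "emeasure M C \<noteq> 0" "emeasure M C \<noteq> emeasure M B"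
      using B by (auto simp: measure_atom_def emeasure_eq_measure2)
    have fC: "C \<in> fmeasurable M" using C B fmeasurableI2 by blast
    have fBC: "B - C \<in> fmeasurable M" using B fC by auto
    have sum: "measure M (B - C) = measure M B - measure M C"
      using measurable_measure_Diff B C by auto
    have "0 < measure M C" "measure M C \<noteq> measure M B"
      using C fC B(1) by (auto simp: emeasure_eq_measure2 zero_less_measure_iff)
    moreover have "measure M C \<le> measure M B" using measure_mono_fmeasurable C B by auto
    ultimately consider "measure M C \<le> measure M B / 2" "0 < measure M C"
      | "measure M (B - C) \<le> measure M B / 2" "0 < measure M (B - C)"
      using sum by linarith
    then show ?case
    proof cases
      case 1 then show ?thesis using fC C B by (intro exI[of _ C]) auto
    next
      case 2 then show ?thesis using fBC C B by (intro exI[of _ "B - C"]) auto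
    qed
  qed
  have "(\<lambda>n. measure M A0 / 2 ^ n) \<longlonglongrightarrow> 0" by (intro LIMSEQ_divide_realpow_zero) auto
  then have "eventually (\<lambda>n. measure M A0 / 2 ^ n < e) sequentially"
    using \<open>0 < e\<close> by (rule order_tendstoD)
  then obtain n where n: "measure M A0 / 2 ^ n < e" by (auto simp: eventually_sequentially)
  obtain B where "B \<in> fmeasurable M" "B \<subseteq> A0" "0 < measure M B" "measure M B \<le> measure M A0 / 2 ^ n"
    using half[of n] by blast
  then show ?thesis using that[of B] n A0 by auto
qed

text \<open>Sierpinski's intermediate value theorem. A set of measure at most \<open>w\<close> whose
  measure cannot be increased has measure \<open>w\<close>, since otherwise a small part of the rest
  of \<open>D\<close> fits into the gap.\<close>

lemma atomless_subset_of_measure: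
  assumes D: "\<And>B. B \<subseteq> D \<Longrightarrow> \<not> measure_atom M B" "D \<in> sets M"
    and w: "0 \<le> w" "ennreal w \<le> emeasure M D"
  obtains B where "B \<in> fmeasurable M" "B \<subseteq> D" "measure M B = w"
proof -
  define S where "S = {X \<in> sets M. X \<subseteq> D \<and> emeasure M X \<le> ennreal w}"
  have fm: "X \<in> fmeasurable M" if "X \<in> S" for X
    using that le_less_trans[OF _ ennreal_less_top] by (auto simp: S_def fmeasurable_def)
  obtain X where X: "X \<in> S" "\<And>Y. \<lbrakk>Y \<in> S; X \<subseteq> Y\<rbrakk> \<Longrightarrow> measure M Y = measure M X"
  proof (rule order_principle[of "{}" S "(\<subseteq>)" "measure M"])
    show "{} \<in> S" by (simp add: S_def)
    show "measure M X \<le> measure M Y" if "X \<in> S" "Y \<in> S" "X \<subseteq> Y" for X Y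
      using that fm by (intro measure_mono_fmeasurable) auto
    show "\<exists>u\<in>S. \<forall>n. X n \<subseteq> u" if X: "\<And>n. X n \<in> S" "\<And>n. X n \<subseteq> X (Suc n)" for X
    proof -
      have "(SUP n. emeasure M (X n)) = emeasure M (\<Union>n. X n)"
        using X by (intro SUP_emeasure_incseq incseq_SucI) (auto simp: S_def)
      moreover have "(SUP n. emeasure M (X n)) \<le> ennreal w" using X(1) by (intro SUP_least) (auto simp: S_def)
      ultimately have "(\<Union>n. X n) \<in> S" using X(1) by (auto simp: S_def)
      then show ?thesis by blast
    qed
  qed (fact subset_refl subset_trans | assumption | blast)+
  have Xw: "measure M X \<le> w" using X(1) fm[OF X(1)] w(1) by (auto simp: S_def emeasure_eq_measure2)
  have "measure M X = w"
  proof (rule ccontr)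
    assume "measure M X \<noteq> w"
    then have e: "0 < w - measure M X" using Xw by simp
    have "emeasure M (D - X) > 0"
    proof (rule ccontr)
      assume "\<not> 0 < emeasure M (D - X)"
      then have "D - X \<in> null_sets M" using D X(1) by (auto simp: null_sets_def S_def)
      then have "emeasure M (X \<union> (D - X)) = emeasure M X"
        using X(1) by (intro emeasure_Un_null_set) (auto simp: S_def)
      moreover have "X \<union> (D - X) = D" using X(1) by (auto simp: S_def)
      ultimately have "ennreal w \<le> ennreal (measure M X)"
        using w fm[OF X(1)] by (simp add: emeasure_eq_measure2)
      then show False using e by (simp add: ennreal_le_iff)
    qed
    then obtain B where B: "B \<in> fmeasurable M" "B \<subseteq> D - X" "0 < measure M B" "measure M B \<le> w - measure M X"
      using atomless_small_subset[where D = D and A = "D - X" and e = "w - measure M X"] e D X(1) by (auto simp: S_def)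
    have "measure M (X \<union> B) = measure M X + measure M B"
      using fm[OF X(1)] B by (intro measure_Un_fmeasurable) auto
    moreover have "X \<union> B \<in> S"
    proof -
      have "X \<union> B \<in> fmeasurable M" using B(1) fm[OF X(1)] by auto
      moreover have "measure M (X \<union> B) \<le> w"
        using \<open>measure M (X \<union> B) = _\<close> B(4) by simp
      ultimately show ?thesis
        using B(2) X(1) emeasure_eq_measure2[of "X \<union> B" M] by (auto simp: S_def ennreal_leI)
    qed
    ultimately show False using X(2)[of "X \<union> B"] B(3) by auto
  qed
  then show ?thesis using that[of X] X(1) fm[OF X(1)] by (auto simp: S_def)
qed

end

section \<open>Set functions determined by the measure\<close>

text \<open>Kept abstract because the theory is applied twice: to the set function obtained from
  \<open>nu\<close>, and to that function minus a multiple of the measure.\<close>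

locale measure_determined = sigma_finite_measure N
  for N :: "'a measure" +
  fixes g :: "'a set \<Rightarrow> real"
  assumes g_sums: "\<lbrakk>range E \<subseteq> sets N; disjoint_family E; (\<Union>i::nat. E i) \<in> fmeasurable N\<rbrakk> \<Longrightarrow>
      (\<lambda>i. g (E i)) sums g (\<Union>i. E i)"
    and g_eq: "\<lbrakk>A \<in> fmeasurable N; B \<in> fmeasurable N; measure N A = measure N B\<rbrakk> \<Longrightarrow> g A = g B"
    and attained: "\<lbrakk>0 \<le> x; ennreal x \<le> emeasure N (space N)\<rbrakk> \<Longrightarrow>
      \<exists>A\<in>fmeasurable N. measure N A = x"
begin

lemma g_empty: "g {} = 0"
proof -
  have "(\<lambda>i::nat. g {}) sums g (\<Union>i::nat. {})"
    by (rule g_sums) (auto simp: disjoint_family_on_def)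
  then have "(\<lambda>i::nat. g {}) \<longlonglongrightarrow> 0" by (intro summable_LIMSEQ_zero) (rule sums_summable)
  then show ?thesis by (simp add: LIMSEQ_const_iff)
qed

lemma g_null: "\<lbrakk>A \<in> fmeasurable N; measure N A = 0\<rbrakk> \<Longrightarrow> g A = 0"
  using g_eq[of A "{}"] g_empty by simp

lemma g_Un:
  assumes "A \<in> fmeasurable N" "B \<in> fmeasurable N" "A \<inter> B = {}"
  shows "g (A \<union> B) = g A + g B"
proof -
  define E where "E i = (if i = 0 then A else if i = 1 then B else {})" for i :: nat
  have U: "(\<Union>i. E i) = A \<union> B" by (auto simp: E_def split: if_splits)
  have "(\<lambda>i. g (E i)) sums g (\<Union>i. E i)"
    using assms by (intro g_sums) (auto simp: E_def disjoint_family_on_def U)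
  moreover have "(\<lambda>i. g (E i)) sums (\<Sum>i\<in>{0, 1}. g (E i))"
    by (rule sums_finite) (auto simp: E_def g_empty)
  ultimately have "g (\<Union>i. E i) = (\<Sum>i\<in>{0, 1}. g (E i))" by (rule sums_unique2)
  then show ?thesis by (simp add: U) (simp add: E_def)
qed

text \<open>Independent of the choice on attained values, because \<open>g\<close> depends on the
  measure alone. Elsewhere the value is unspecified, so statements about \<open>f x\<close> go
  through a set of measure \<open>x\<close>.\<close>

definition f :: "real \<Rightarrow> real" where
  "f x = g (SOME A. A \<in> fmeasurable N \<and> measure N A = x)"

lemma f_measure:
  assumes "A \<in> fmeasurable N"
  shows "f (measure N A) = g A"
proof -
  let ?B = "SOME B. B \<in> fmeasurable N \<and> measure N B = measure N A"
  have "?B \<in> fmeasurable N \<and> measure N ?B = measure N A"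
    by (rule someI[of _ A]) (use assms in simp)
  then show ?thesis unfolding f_def using g_eq assms by blast
qed

lemma f_add:
  assumes "A \<in> fmeasurable N" "B \<in> fmeasurable N" "A \<inter> B = {}"
  shows "f (measure N A + measure N B) = f (measure N A) + f (measure N B)"
  using f_measure[OF assms(1)] f_measure[OF assms(2)] f_measure[of "A \<union> B"] g_Un[OF assms]
    measure_Un_fmeasurable[OF assms] fmeasurable.Un[OF assms(1,2)] by simp

end

section \<open>Representing numbers by the atomless part and by small atoms\<close>

locale atomic_partition = measure_determined +
  fixes F :: "'a set set"
  assumes countable_F: "countable F" and disjoint_F: "disjoint F"
    and atom_F: "A \<in> F \<Longrightarrow> measure_atom N A"
    and no_atom: "B \<subseteq> space N - \<Union>F \<Longrightarrow> \<not> measure_atom N B"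
begin

definition D :: "'a set" where "D = space N - \<Union>F"

text \<open>The part of the space available to sets that use only atoms below \<open>z\<close>. The
  strict inequality keeps it disjoint from every atom in \<open>F\<close> of measure at least
  \<open>z\<close>.\<close>

definition G :: "real \<Rightarrow> 'a set" where "G z = D \<union> \<Union>{A\<in>F. measure N A < z}"

lemma F_sets: "A \<in> F \<Longrightarrow> A \<in> sets N"
  using atom_F by (auto simp: measure_atom_def)

lemma F_fmeasurable: "A \<in> F \<Longrightarrow> A \<in> fmeasurable N"
  using atom_F atom_fmeasurable by blast

lemma F_pos: "A \<in> F \<Longrightarrow> measure N A > 0"
  using atom_F atom_measure_pos by blast

lemma F_Int: "\<lbrakk>A \<in> F; B \<in> F; A \<noteq> B\<rbrakk> \<Longrightarrow> A \<inter> B = {}"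
  using disjoint_F by (rule disjointD)

lemma Union_F_sets: "Y \<subseteq> F \<Longrightarrow> \<Union>Y \<in> sets N"
  using countable_F F_sets countable_subset by (intro sets.countable_Union) auto

lemma D_sets: "D \<in> sets N"
  using Union_F_sets[of F] by (auto simp: D_def)

lemma D_no_atom: "B \<subseteq> D \<Longrightarrow> \<not> measure_atom N B"
  using no_atom by (simp add: D_def)

lemma G_sets: "G z \<in> sets N"
  using D_sets Union_F_sets[of "{A\<in>F. measure N A < z}"] by (auto simp: G_def)

lemma space_eq: "space N = D \<union> \<Union>F"
  using Union_F_sets[of F] sets.sets_into_space by (auto simp: D_def)

lemma D_Int_F: "A \<in> F \<Longrightarrow> D \<inter> A = {}"
  by (auto simp: D_def)

lemma disjoint_part:
  assumes "B \<subseteq> D \<union> \<Union>Y" "Y \<subseteq> F" "A \<in> F" "A \<notin> Y"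
  shows "B \<inter> A = {}"
  using assms D_Int_F[of A] F_Int[of A] by blast

lemma measure_Union_F:
  assumes "finite Y" "Y \<subseteq> F"
  shows "\<Union>Y \<in> fmeasurable N" "measure N (\<Union>Y) = (\<Sum>A\<in>Y. measure N A)"
proof -
  have "disjoint_family_on (\<lambda>A. A) Y" unfolding disjoint_family_on_def using F_Int assms(2) by blast
  then have "measure N (\<Union>A\<in>Y. A) = (\<Sum>A\<in>Y. measure N A)"
    using assms F_fmeasurable by (intro measure_finite_Union) (auto simp: emeasure_eq_measure2 subset_eq)
  then show "measure N (\<Union>Y) = (\<Sum>A\<in>Y. measure N A)" by simp
  show "\<Union>Y \<in> fmeasurable N"
    using assms F_fmeasurable by (induction Y rule: finite_induct) auto
qed

lemma Int_fmeasurable: "\<lbrakk>W \<in> fmeasurable N; A \<in> sets N\<rbrakk> \<Longrightarrow> W \<inter> A \<in> fmeasurable N"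
  by (rule fmeasurable_Int_fmeasurable)

lemma g_bound:
  assumes W: "W \<in> fmeasurable N" and D: "\<bar>g (W \<inter> D)\<bar> \<le> K * measure N (W \<inter> D)"
    and F: "\<And>A. A \<in> F \<Longrightarrow> \<bar>g (W \<inter> A)\<bar> \<le> K * measure N (W \<inter> A)"
  shows "\<bar>g W\<bar> \<le> K * measure N W"
proof -
  define C where "C i = (case i of 0 \<Rightarrow> D
    | Suc j \<Rightarrow> if j \<in> to_nat_on F ` F then from_nat_into F j else {})" for i
  have CF: "C (Suc j) \<in> F \<and> to_nat_on F (C (Suc j)) = j \<or> C (Suc j) = {}" for j
    using countable_F by (auto simp: C_def)
  have C_sets: "C i \<in> sets N" for i
  proof (cases i)
    case 0 then show ?thesis using D_sets by (simp add: C_def)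
  next
    case (Suc j) then show ?thesis using CF[of j] F_sets by auto
  qed
  have C_dis: "C i \<inter> C j = {}" if "i < j" for i j
  proof -
    obtain j' where j': "j = Suc j'" using \<open>i < j\<close> by (cases j) auto
    show ?thesis
    proof (cases i)
      case 0
      then have "C i = D" by (simp add: C_def)
      then show ?thesis using CF[of j'] D_Int_F[of "C j"] j' by auto
    next
      case (Suc i')
      then have "i' \<noteq> j'" using \<open>i < j\<close> j' by simp
      show ?thesis
      proof (cases "C i = {} \<or> C j = {}")
        case False
        then have F: "C i \<in> F" "C j \<in> F" and t: "to_nat_on F (C i) = i'" "to_nat_on F (C j) = j'"
          using CF[of i'] CF[of j'] Suc j' by simp_all
        have "C i \<noteq> C j" using t \<open>i' \<noteq> j'\<close> by metis
        with F show ?thesis by (rule F_Int)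
      qed auto
    qed
  qed
  have C_UN: "(\<Union>i. C i) = space N"
  proof -
    have "A \<subseteq> (\<Union>i. C i)" if "A \<in> F" for A
    proof -
      have "C (Suc (to_nat_on F A)) = A" using that countable_F by (simp add: C_def)
      then show ?thesis by blast
    qed
    moreover have "D = C 0" by (simp add: C_def)
    ultimately have "space N \<subseteq> (\<Union>i. C i)" unfolding space_eq by blast
    then show ?thesis using C_sets sets.sets_into_space by blast
  qed
  define E where "E i = W \<inter> C i" for i
  have E: "range E \<subseteq> sets N" using W C_sets by (auto simp: E_def)
  have E_dis: "disjoint_family E" unfolding disjoint_family_on_def
  proof (intro ballI impI)
    fix i j :: nat assume "i \<noteq> j"
    then have "C i \<inter> C j = {}" using C_dis[of i j] C_dis[of j i] by (cases "i < j") auto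
    then show "E i \<inter> E j = {}" by (auto simp: E_def)
  qed
  have E_UN: "(\<Union>i. E i) = W"
    using C_UN sets.sets_into_space[of W N] W by (auto simp: E_def)
  have gs: "(\<lambda>i. g (E i)) sums g W"
    using g_sums[OF E E_dis] W by (simp add: E_UN)
  have ms: "(\<lambda>i. K * measure N (E i)) sums (K * measure N W)"
    using measure_UNION[OF E E_dis] W by (intro sums_mult) (simp add: E_UN emeasure_eq_measure2)
  have le: "\<bar>g (E i)\<bar> \<le> K * measure N (E i)" for i
  proof (cases i)
    case 0 then show ?thesis using D by (simp add: E_def C_def)
  next
    case (Suc j) then show ?thesis using CF[of j] F g_empty by (auto simp: E_def)
  qed
  have "g W \<le> K * measure N W" using le by (intro sums_le[OF _ gs ms]) (simp add: abs_le_iff)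
  moreover have "- (K * measure N W) \<le> g W"
    using le by (intro sums_le[OF _ sums_minus[OF ms] gs]) (simp add: abs_le_iff minus_le_iff)
  ultimately show ?thesis by (simp add: abs_le_iff)
qed

lemma null_on_Union:
  assumes "B \<in> fmeasurable N" "Y \<subseteq> F" "\<And>A. A \<in> Y \<Longrightarrow> measure N (B \<inter> A) = 0"
  shows "B \<inter> \<Union>Y \<in> null_sets N"
proof -
  have "(\<Union>A\<in>Y. B \<inter> A) \<in> null_sets N"
  proof (rule null_sets_UN')
    show "countable Y" using countable_subset assms(2) countable_F by blast
    fix A assume "A \<in> Y"
    then have "B \<inter> A \<in> fmeasurable N" using assms F_sets by (intro Int_fmeasurable) auto
    then show "B \<inter> A \<in> null_sets N"
      using assms(3)[OF \<open>A \<in> Y\<close>] by (auto simp: null_sets_def emeasure_eq_measure2)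
  qed
  moreover have "(\<Union>A\<in>Y. B \<inter> A) = B \<inter> \<Union>Y" by auto
  ultimately show ?thesis by simp
qed

text \<open>A set of measure \<open>r\<close> meets an atom larger than \<open>r\<close> in measure
  0, since the only alternative is the full measure of the atom. Deleting these countably many null
  pieces does not change the measure.\<close>

lemma attained_small_atoms:
  assumes "0 \<le> r" "ennreal r \<le> emeasure N (space N)"
  obtains B where "B \<in> fmeasurable N" "measure N B = r" "B \<subseteq> D \<union> \<Union>{A\<in>F. measure N A \<le> r}"
proof -
  obtain B where B: "B \<in> fmeasurable N" "measure N B = r" using attained[OF assms] by blast
  define Y where "Y = {A\<in>F. r < measure N A}"
  have YF: "Y \<subseteq> F" by (auto simp: Y_def)
  have "B \<inter> \<Union>Y \<in> null_sets N"
  proof (rule null_on_Union[OF B(1) YF])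
    fix A assume "A \<in> Y"
    then have A: "A \<in> F" "r < measure N A" by (auto simp: Y_def)
    have "measure N (B \<inter> A) \<le> r"
      using B A F_sets by (metis Int_lower1 measure_mono_fmeasurable fmeasurableD sets.Int)
    then show "measure N (B \<inter> A) = 0" using atom_Int_cases[OF atom_F, of A B] A B by force
  qed
  then have "measure N (B - B \<inter> \<Union>Y) = r"
    using B measure_Diff_null_set[of B N "B \<inter> \<Union>Y"] by auto
  moreover have "B - B \<inter> \<Union>Y = B - \<Union>Y" by auto
  moreover have "B - \<Union>Y \<in> fmeasurable N" using B Union_F_sets[OF YF] by (intro fmeasurable_Diff)
  moreover have "B - \<Union>Y \<subseteq> D \<union> \<Union>{A\<in>F. measure N A \<le> r}"
  proof
    fix x assume x: "x \<in> B - \<Union>Y"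
    then have "x \<in> space N" using sets.sets_into_space[of B N] B(1) by auto
    then consider "x \<in> D" | A where "A \<in> F" "x \<in> A" unfolding space_eq by blast
    then show "x \<in> D \<union> \<Union>{A\<in>F. measure N A \<le> r}"
    proof cases
      case 2
      then have "measure N A \<le> r" using x by (auto simp: Y_def not_less[symmetric])
      then show ?thesis using 2 by blast
    qed simp
  qed
  ultimately show ?thesis using that by simp
qed

text \<open>Continuity from below along an enumeration of the countable family.\<close>

lemma finite_atoms_exceed:
  assumes Y: "Y \<subseteq> F" and w: "ennreal w < emeasure N (\<Union>Y)"
  obtains Y0 where "finite Y0" "Y0 \<subseteq> Y" "w < (\<Sum>A\<in>Y0. measure N A)"
proof -
  have "Y \<noteq> {}" using w by auto
  have cY: "countable Y" using Y countable_F countable_subset by blast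
  define Z where "Z n = from_nat_into Y ` {..n}" for n
  have Z: "finite (Z n)" "Z n \<subseteq> Y" for n
    using from_nat_into[OF \<open>Y \<noteq> {}\<close>] by (auto simp: Z_def)
  have UY: "\<Union>Y = (\<Union>n. \<Union>(Z n))"
  proof
    show "\<Union>Y \<subseteq> (\<Union>n. \<Union>(Z n))"
    proof
      fix x assume "x \<in> \<Union>Y"
      then obtain A where A: "A \<in> Y" "x \<in> A" by blast
      obtain n where "from_nat_into Y n = A" using from_nat_into_surj[OF cY A(1)] by blast
      then have "A \<in> Z n" by (auto simp: Z_def)
      then show "x \<in> (\<Union>n. \<Union>(Z n))" using A by blast
    qed
    show "(\<Union>n. \<Union>(Z n)) \<subseteq> \<Union>Y" using Z by blast
  qed
  have "(SUP n. emeasure N (\<Union>(Z n))) = emeasure N (\<Union>n. \<Union>(Z n))"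
  proof (rule SUP_emeasure_incseq)
    show "range (\<lambda>n. \<Union>(Z n)) \<subseteq> sets N" using Z Y Union_F_sets by (auto simp: subset_eq)
    show "incseq (\<lambda>n. \<Union>(Z n))" by (rule monoI) (fastforce simp: Z_def)
  qed
  then obtain n where n: "ennreal w < emeasure N (\<Union>(Z n))"
    using w unfolding UY by (metis less_SUP_iff)
  have "Z n \<subseteq> F" using Z Y by blast
  then have "w < (\<Sum>A\<in>Z n. measure N A)"
    using n measure_Union_F[OF Z(1)] emeasure_eq_measure2[of "\<Union>(Z n)" N]
    by (metis ennreal_leI not_le)
  then show ?thesis using that Z by blast
qed

text \<open>Discard a least term until the sum no longer exceeds \<open>w\<close>. The last
  discarded term \<open>m B\<close> is at most every remaining one, so the deficit is smaller than
  each remaining term. This is what makes a filler of that size disjoint from the selected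
  atoms.\<close>

lemma greedy_atoms:
  assumes "finite Y0" "w < (\<Sum>A\<in>Y0. m A)" "0 \<le> (w::real)"
  obtains Y B where "Y \<subseteq> Y0" "(\<Sum>A\<in>Y. m A) \<le> w" "\<And>A. A \<in> Y \<Longrightarrow> w < (\<Sum>A\<in>Y. m A) + m A"
    "B \<in> Y0" "w < (\<Sum>A\<in>Y. m A) + m B"
proof -
  have "\<exists>Y\<subseteq>Y0. (\<Sum>A\<in>Y. m A) \<le> w \<and> (\<forall>A\<in>Y. w < (\<Sum>A\<in>Y. m A) + m A) \<and>
      (\<exists>B\<in>Y0. w < (\<Sum>A\<in>Y. m A) + m B)"
    using assms(1,2)
  proof (induction rule: finite_psubset_induct)
    case (psubset Y0)
    then have "Y0 \<noteq> {}" using assms(3) by auto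
    have "Min (m ` Y0) \<in> m ` Y0" using psubset(1) \<open>Y0 \<noteq> {}\<close> by (intro Min_in) auto
    then obtain B where B: "B \<in> Y0" "m B = Min (m ` Y0)" by (auto simp: image_iff)
    then have least: "m B \<le> m A" if "A \<in> Y0" for A using psubset(1) that by simp
    have sum: "(\<Sum>A\<in>Y0. m A) = m B + (\<Sum>A\<in>Y0 - {B}. m A)"
      using psubset(1) B(1) by (rule sum.remove)
    show ?case
    proof (cases "(\<Sum>A\<in>Y0 - {B}. m A) \<le> w")
      case True
      have "w < (\<Sum>A\<in>Y0 - {B}. m A) + m A" if "A \<in> Y0" for A
        using least[OF that] sum psubset.prems by linarith
      then show ?thesis using True B by (intro exI[of _ "Y0 - {B}"]) auto
    next
      case False
      have "Y0 - {B} \<subset> Y0" using B by auto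
      from psubset.IH[OF this] False show ?thesis by (meson Diff_subset not_le subset_trans subsetD)
    qed
  qed
  then show ?thesis using that by blast
qed

text \<open>If the atoms of \<open>G z\<close> alone exceed \<open>w\<close>, take a greedy
  selection and fill the deficit \<open>r\<close> from \<open>D\<close> and atoms of measure at most
  \<open>r\<close>; all selected atoms are larger than \<open>r\<close>, so the two parts are
  disjoint. Otherwise take all the atoms and cut the rest out of the atomless
  \<open>D\<close>.\<close>

lemma G_attains:
  assumes w: "0 \<le> w" "ennreal w \<le> emeasure N (G z)"
  obtains B where "B \<in> fmeasurable N" "B \<subseteq> G z" "measure N B = w"
proof -
  define Y where "Y = {A\<in>F. measure N A < z}"
  have YF: "Y \<subseteq> F" by (auto simp: Y_def)
  have G: "G z = D \<union> \<Union>Y" by (simp add: G_def Y_def)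
  have DY: "D \<inter> \<Union>Y = {}" using YF D_Int_F by blast
  have Gsp: "emeasure N (G z) \<le> emeasure N (space N)" by (rule emeasure_space)
  show ?thesis
  proof (cases "ennreal w < emeasure N (\<Union>Y)")
    case True
    obtain Y0 where Y0: "finite Y0" "Y0 \<subseteq> Y" "w < (\<Sum>A\<in>Y0. measure N A)"
      using finite_atoms_exceed[OF YF True] by blast
    obtain X B where X: "X \<subseteq> Y0" "(\<Sum>A\<in>X. measure N A) \<le> w"
      "\<And>A. A \<in> X \<Longrightarrow> w < (\<Sum>A\<in>X. measure N A) + measure N A"
      "B \<in> Y0" "w < (\<Sum>A\<in>X. measure N A) + measure N B"
      using greedy_atoms[OF Y0(1,3) w(1)] by metis
    define r where "r = w - (\<Sum>A\<in>X. measure N A)"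
    have X': "finite X" "X \<subseteq> F" using X(1) Y0 YF finite_subset by auto
    \<comment> \<open>\<open>r\<close> is below the measure of the discarded atom \<open>B\<close>,
      which is below \<open>z\<close>; hence the filler stays inside \<open>G z\<close>.\<close>
    have r: "0 \<le> r" "r \<le> w" "r < z"
      using X Y0(2) by (auto simp: r_def Y_def sum_nonneg)
    then have "ennreal r \<le> emeasure N (space N)"
      using w Gsp ennreal_leI order_trans by metis
    then obtain T where T: "T \<in> fmeasurable N" "measure N T = r"
      "T \<subseteq> D \<union> \<Union>{A\<in>F. measure N A \<le> r}"
      using attained_small_atoms r(1) by blast
    have "T \<inter> A = {}" if "A \<in> X" for A
      using X(3)[OF that] that X' by (intro disjoint_part[OF T(3)]) (auto simp: r_def)
    then have "T \<inter> \<Union>X = {}" by blast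
    then have "measure N (T \<union> \<Union>X) = w"
      using measure_Un_fmeasurable[OF T(1) measure_Union_F(1)[OF X']] measure_Union_F(2)[OF X'] T(2)
      by (simp add: r_def)
    moreover have "T \<union> \<Union>X \<in> fmeasurable N" using T(1) measure_Union_F(1)[OF X'] by auto
    moreover have "T \<union> \<Union>X \<subseteq> G z"
    proof -
      have "{A\<in>F. measure N A \<le> r} \<subseteq> Y" using r(3) by (auto simp: Y_def)
      moreover have "X \<subseteq> Y" using X(1) Y0(2) by blast
      ultimately show ?thesis unfolding G using T(3) by blast
    qed
    ultimately show ?thesis using that by blast
  next
    case False
    then have fin: "\<Union>Y \<in> fmeasurable N" using Union_F_sets[OF YF] le_less_trans[OF _ ennreal_less_top]
      by (auto simp: fmeasurable_def not_less)
    then have le: "measure N (\<Union>Y) \<le> w" using False w by (simp add: emeasure_eq_measure2 not_less)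
    have "emeasure N (G z) = emeasure N D + measure N (\<Union>Y)"
      unfolding G using plus_emeasure[OF D_sets Union_F_sets[OF YF] DY] emeasure_eq_measure2[OF fin] by simp
    then have "ennreal (w - measure N (\<Union>Y)) \<le> emeasure N D"
      using w le by (metis ennreal_minus measure_nonneg ennreal_minus_le_iff ennreal_neq_top add.commute)
    then obtain B where B: "B \<in> fmeasurable N" "B \<subseteq> D" "measure N B = w - measure N (\<Union>Y)"
      using atomless_subset_of_measure[OF D_no_atom D_sets] le by (metis diff_ge_0_iff_ge)
    then have "B \<inter> \<Union>Y = {}" using DY by blast
    then have "measure N (B \<union> \<Union>Y) = w" using measure_Un_fmeasurable[OF B(1) fin] B(3) by simp
    then show ?thesis using that[of "B \<union> \<Union>Y"] B fin by (auto simp: G)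
  qed
qed

section \<open>Vanishing near zero propagates to all sets of finite measure\<close>

lemma g_eq_zero:
  assumes W: "W \<in> fmeasurable N" and "0 < z"
    and small: "\<And>B. \<lbrakk>B \<in> fmeasurable N; measure N B < z\<rbrakk> \<Longrightarrow> g B = 0"
    and atoms: "\<And>A. \<lbrakk>A \<in> F; measure N (W \<inter> A) = measure N A\<rbrakk> \<Longrightarrow> g A = 0"
  shows "g W = 0"
proof -
  \<comment> \<open>On the atomless part, cut off pieces of measure \<open>z / 2\<close>, to which
    \<open>small\<close> applies, until less than \<open>z\<close> remains.\<close>
  have D0: "g B = 0" if "B \<in> fmeasurable N" "B \<subseteq> D" "measure N B \<le> real n * (z / 2)" for B n
    using that
  proof (induction n arbitrary: B)
    case 0 then show ?case using small[of B] \<open>0 < z\<close> by simp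
  next
    case (Suc n)
    show ?case
    proof (cases "measure N B < z")
      case True then show ?thesis using small Suc.prems by blast
    next
      case False
      have "\<not> measure_atom N X" if "X \<subseteq> B" for X using D_no_atom that Suc.prems by blast
      moreover have "ennreal (z / 2) \<le> emeasure N B"
        using False \<open>0 < z\<close> Suc.prems(1) by (simp add: emeasure_eq_measure2 ennreal_leI)
      ultimately obtain C where C: "C \<in> fmeasurable N" "C \<subseteq> B" "measure N C = z / 2"
        using atomless_subset_of_measure[of B "z / 2"] Suc.prems(1) \<open>0 < z\<close> by auto
      have BC: "B - C \<in> fmeasurable N" using C(1) Suc.prems(1) by auto
      have un: "C \<union> (B - C) = B" using C(2) by auto
      have "measure N B = measure N C + measure N (B - C)"
        using measure_Un_fmeasurable[OF C(1) BC] un by auto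
      then have "g (B - C) = 0" using Suc C BC by (intro Suc.IH) (auto simp: algebra_simps)
      moreover have "g C = 0" using small[OF C(1)] C(3) \<open>0 < z\<close> by simp
      ultimately show ?thesis using g_Un[OF C(1) BC] un by auto
    qed
  qed
  have WD: "g (W \<inter> D) = 0"
  proof -
    obtain n where "measure N (W \<inter> D) \<le> real n * (z / 2)"
      using reals_Archimedean3[of "z / 2"] \<open>0 < z\<close> less_imp_le by fastforce
    then show ?thesis using D0 Int_fmeasurable[OF W D_sets] by blast
  qed
  have WA: "g (W \<inter> A) = 0" if A: "A \<in> F" for A
  proof -
    have fm: "W \<inter> A \<in> fmeasurable N" using Int_fmeasurable[OF W F_sets[OF A]] .
    have "measure N (W \<inter> A) = 0 \<or> measure N (W \<inter> A) = measure N A"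
      using atom_Int_cases[OF atom_F[OF A]] W by blast
    then show ?thesis
      using g_null[OF fm] g_eq[OF fm F_fmeasurable[OF A]] atoms[OF A] by auto
  qed
  show ?thesis using g_bound[OF W, of 0] WD WA by simp
qed

lemma le_space: "A \<in> fmeasurable N \<Longrightarrow> x \<le> measure N A \<Longrightarrow> ennreal x \<le> emeasure N (space N)"
  using emeasure_space[of N A] by (metis emeasure_eq_measure2 ennreal_leI order_trans)

text \<open>If \<open>G z\<close> were smaller, a number \<open>r\<close> strictly between its
  measure and \<open>z\<close> would be represented using only \<open>D\<close> and atoms of measure
  at most \<open>r < z\<close>, hence inside \<open>G z\<close>.\<close>

lemma G_measure_ge:
  assumes "0 < z" "ennreal z \<le> emeasure N (space N)"
  shows "ennreal z \<le> emeasure N (G z)"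
proof (rule ccontr)
  assume less: "\<not> ennreal z \<le> emeasure N (G z)"
  then have fm: "G z \<in> fmeasurable N" using G_sets by (auto simp: fmeasurable_def not_le intro: less_trans)
  then have t: "measure N (G z) < z" using less ennreal_leI[of z "measure N (G z)"]
    by (auto simp: emeasure_eq_measure2 not_le[symmetric])
  define r where "r = (measure N (G z) + z) / 2"
  have r: "0 \<le> r" "r < z" "measure N (G z) < r" using t measure_nonneg[of N "G z"] \<open>0 < z\<close> by (auto simp: r_def)
  then have "ennreal r \<le> emeasure N (space N)"
    using assms by (metis ennreal_leI less_imp_le order_trans)
  then obtain B where B: "B \<in> fmeasurable N" "measure N B = r" "B \<subseteq> D \<union> \<Union>{A\<in>F. measure N A \<le> r}"
    using attained_small_atoms r(1) by blast
  have "B \<subseteq> G z" using B(3) r(2) by (fastforce simp: G_def)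
  then show False using measure_mono_fmeasurable[OF _ _ fm, of B] B r by auto
qed

text \<open>Beyond the largest \<open>z\<close> with \<open>g = 0\<close> on sets of measure at most \<open>z\<close> there would be
  atoms \<open>A\<^sub>1, A\<^sub>2, A\<^sub>3\<close> of measure slightly above \<open>z\<close> on which \<open>g\<close> has a common value
  \<open>p \<noteq> 0\<close>. The measure of \<open>A\<^sub>2 \<union> A\<^sub>3\<close> exceeds that of \<open>A\<^sub>1\<close> by less than \<open>z\<close>, so
  \<open>g (A\<^sub>2 \<union> A\<^sub>3)\<close> is both \<open>2 p\<close> and \<open>p\<close>.\<close>

lemma g_vanishes:
  assumes "0 < z0" and z0: "\<And>B. \<lbrakk>B \<in> fmeasurable N; measure N B \<le> z0\<rbrakk> \<Longrightarrow> g B = 0"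
    and W0: "W0 \<in> fmeasurable N"
  shows "g W0 = 0"
proof (rule ccontr)
  assume "g W0 \<noteq> 0"
  define S where "S = {x. \<forall>B\<in>fmeasurable N. measure N B \<le> x \<longrightarrow> g B = 0}"
  define z where "z = Sup S"
  have bdd: "bdd_above S"
    using W0 \<open>g W0 \<noteq> 0\<close> by (intro bdd_aboveI[of _ "measure N W0"]) (force simp: S_def)
  have z0S: "z0 \<in> S" using z0 by (simp add: S_def)
  then have "z0 \<le> z" using bdd unfolding z_def by (rule cSup_upper)
  then have "0 < z" using \<open>0 < z0\<close> by simp
  have below: "g B = 0" if B: "B \<in> fmeasurable N" "measure N B < z" for B
  proof -
    obtain x where "x \<in> S" "measure N B < x"
      using less_cSupE[of "measure N B" S] B(2) z0S unfolding z_def by blast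
    then show ?thesis using B(1) by (simp add: S_def)
  qed
  \<comment> \<open>The value \<open>z\<close> itself is harmless: it is represented inside
    \<open>G z\<close>, where every atom is smaller than \<open>z\<close>.\<close>
  have at: "g B = 0" if B: "B \<in> fmeasurable N" "measure N B = z" for B
  proof -
    have "ennreal z \<le> emeasure N (G z)"
      using G_measure_ge[OF \<open>0 < z\<close>] le_space[OF B(1)] B(2) by simp
    then obtain T where T: "T \<in> fmeasurable N" "T \<subseteq> G z" "measure N T = z"
      using G_attains \<open>0 < z\<close> less_imp_le by metis
    have "g T = 0"
    proof (rule g_eq_zero[OF T(1) \<open>0 < z\<close> below])
      fix A assume A: "A \<in> F" "measure N (T \<inter> A) = measure N A"
      have "measure N A < z"
      proof (rule ccontr)
        assume "\<not> measure N A < z"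
        then have "T \<inter> A = {}" using A(1) T(2) by (intro disjoint_part) (auto simp: G_def)
        then show False using A F_pos[OF A(1)] by simp
      qed
      then show "g A = 0" using below F_fmeasurable[OF A(1)] by blast
    qed
    then show ?thesis using g_eq[OF B(1) T(1)] B(2) T(3) by simp
  qed
  \<comment> \<open>Some set of measure slightly above \<open>z\<close> has nonzero
    \<open>g\<close>; by \<open>g_eq_zero\<close> an atom contained in it up to a null set is
    responsible, and \<open>below\<close> and \<open>at\<close> push that atom above
    \<open>z\<close>.\<close>
  have above: "\<exists>A\<in>F. z < measure N A \<and> measure N A < z + \<eta> \<and> g A \<noteq> 0" if "0 < \<eta>" for \<eta>
  proof -
    have "z + \<eta> / 2 \<notin> S" using cSup_upper[OF _ bdd, of "z + \<eta> / 2"] that by (auto simp: z_def)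
    then obtain W where W: "W \<in> fmeasurable N" "measure N W \<le> z + \<eta> / 2" "g W \<noteq> 0"
      by (auto simp: S_def)
    have "\<exists>A\<in>F. measure N (W \<inter> A) = measure N A \<and> g A \<noteq> 0"
      using g_eq_zero[OF W(1) \<open>0 < z\<close> below] W(3) by blast
    then obtain A where A: "A \<in> F" "measure N (W \<inter> A) = measure N A" "g A \<noteq> 0" by blast
    have "measure N A \<le> measure N W"
      using A(2) measure_mono_fmeasurable[of "W \<inter> A" W N] W(1) F_sets[OF A(1)] by auto
    moreover have "z < measure N A"
      using below[of A] at[of A] F_fmeasurable[OF A(1)] A(3) by force
    ultimately show ?thesis using A W(2) that by (intro bexI[of _ A]) auto
  qed
  \<comment> \<open>A filler of measure \<open>t < z\<close> avoids the larger atom \<open>A\<close>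
    and carries the value 0, so \<open>f\<close> stays constant on an interval of length
    \<open>z\<close> to the right of \<open>measure N A\<close>.\<close>
  have shift: "f (measure N A + t) = g A" if A: "A \<in> F" "z < measure N A" and t: "0 \<le> t" "t < z" for A t
  proof -
    have "ennreal t \<le> emeasure N (space N)" using le_space[OF F_fmeasurable[OF A(1)]] A(2) t(2) by simp
    then obtain T where T: "T \<in> fmeasurable N" "measure N T = t" "T \<subseteq> D \<union> \<Union>{A\<in>F. measure N A \<le> t}"
      using attained_small_atoms t(1) by blast
    have "T \<inter> A = {}" using A t by (intro disjoint_part[OF T(3)]) auto
    then have "f (measure N A + measure N T) = f (measure N A) + f (measure N T)"
      using F_fmeasurable[OF A(1)] T(1) by (intro f_add) auto
    then show ?thesis using below[OF T(1)] f_measure[OF T(1)] T(2) t f_measure[OF F_fmeasurable[OF A(1)]]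
      by simp
  qed
  \<comment> \<open>The bound \<open>z + z\<close> keeps the distances from \<open>A2\<close> and
    \<open>A3\<close> to \<open>A1\<close> below \<open>z\<close>. Halving the excess of
    \<open>A1\<close> over \<open>z\<close> makes the excesses of \<open>A2\<close> and
    \<open>A3\<close> together smaller than that of \<open>A1\<close>, and the strict bound for
    \<open>A3\<close> separates it from \<open>A2\<close>.\<close>
  obtain A1 where A1: "A1 \<in> F" "z < measure N A1" "measure N A1 < z + z" "g A1 \<noteq> 0"
    using above[OF \<open>0 < z\<close>] by blast
  obtain A2 where A2: "A2 \<in> F" "z < measure N A2" "measure N A2 < z + (measure N A1 - z) / 2"
    using above[of "(measure N A1 - z) / 2"] A1(2) by auto
  obtain A3 where A3: "A3 \<in> F" "z < measure N A3" "measure N A3 < z + (measure N A2 - z)"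
    using above[of "measure N A2 - z"] A2(2) by auto
  have le: "measure N A2 \<le> measure N A1" "measure N A3 \<le> measure N A1"
    using A1(2) A2(3) A3(3) by (simp_all add: field_simps)
  have "g A2 = g A1" "g A3 = g A1"
    using le shift[OF A2(1,2), of "measure N A1 - measure N A2"]
      shift[OF A3(1,2), of "measure N A1 - measure N A3"]
      f_measure[OF F_fmeasurable[OF A1(1)]] A1 A2 A3 by auto
  moreover have "f (measure N A2 + measure N A3) = g A2 + g A3"
  proof -
    have "A2 \<noteq> A3" using A3(3) by auto
    then show ?thesis
      using f_add[OF F_fmeasurable[OF A2(1)] F_fmeasurable[OF A3(1)] F_Int[OF A2(1) A3(1)]]
        f_measure F_fmeasurable A2(1) A3(1) by simp
  qed
  moreover have "measure N A2 + measure N A3 - measure N A1 < z"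
    using A2(3) A3(3) by (simp add: field_simps)
  then have "f (measure N A2 + measure N A3) = g A1"
    using shift[OF A1(1,2), of "measure N A2 + measure N A3 - measure N A1"] A1 A2 A3 by auto
  ultimately show False using A1(4) by simp
qed

section \<open>Linearity near zero\<close>

lemma local_linear_atomless:
  assumes "emeasure N D > 0"
  obtains x0 \<alpha> where "0 < x0" "\<And>B. \<lbrakk>B \<in> fmeasurable N; measure N B \<le> x0\<rbrakk> \<Longrightarrow> g B = \<alpha> * measure N B"
proof -
  obtain D0 where D0: "D0 \<in> fmeasurable N" "D0 \<subseteq> D" "emeasure N D0 > 0"
    using exists_fmeasurable_subset[OF D_sets assms] by blast
  define c where "c = measure N D0"
  have "0 < c" using D0 by (simp add: c_def emeasure_eq_measure2)
  have sub: "\<exists>B\<in>fmeasurable N. B \<subseteq> X \<and> measure N B = x"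
    if X: "X \<in> fmeasurable N" "X \<subseteq> D0" and x: "0 \<le> x" "x \<le> measure N X" for X x
  proof -
    have "\<not> measure_atom N B" if "B \<subseteq> X" for B using D_no_atom that X(2) D0(2) by blast
    moreover have "ennreal x \<le> emeasure N X" using x X(1) by (simp add: emeasure_eq_measure2 ennreal_leI)
    ultimately show ?thesis using atomless_subset_of_measure[of X x] X(1) x(1) by auto
  qed
  \<comment> \<open>\<open>x\<close> and \<open>y\<close> are realised disjointly in
    \<open>D0\<close>: once \<open>B\<close> is cut out, the rest still has measure at least
    \<open>y\<close>.\<close>
  have add: "f (x + y) = f x + f y" if xy: "0 \<le> x" "0 \<le> y" "x + y \<le> c" for x y
  proof -
    obtain B where B: "B \<in> fmeasurable N" "B \<subseteq> D0" "measure N B = x"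
      using sub[OF D0(1), of x] xy by (auto simp: c_def)
    have D0B: "D0 - B \<in> fmeasurable N" using D0(1) B(1) by auto
    have "B \<union> (D0 - B) = D0" using B(2) by auto
    then have "measure N (D0 - B) = c - x"
      using measure_Un_fmeasurable[OF B(1) D0B] B(3) by (auto simp: c_def)
    then obtain C where C: "C \<in> fmeasurable N" "C \<subseteq> D0 - B" "measure N C = y"
      using sub[OF D0B, of y] xy by auto
    then have "B \<inter> C = {}" by auto
    then show ?thesis using f_add[OF B(1) C(1)] B(3) C(3) by simp
  qed
  \<comment> \<open>Restricted to \<open>D0\<close>, \<open>g\<close> is a real-valued signed
    measure, so its Hahn decomposition bounds it on all subsets of \<open>D0\<close>.\<close>
  have sgn: "signed_measure N (\<lambda>A. ereal (g (A \<inter> D0)))"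
    unfolding signed_measure_def countably_additive_signed_def
  proof (intro conjI allI impI)
    show "ereal (g ({} \<inter> D0)) = 0" by (simp add: g_empty)
    show "\<not> (\<infinity> \<in> (\<lambda>A. ereal (g (A \<inter> D0))) ` sets N \<and> - \<infinity> \<in> (\<lambda>A. ereal (g (A \<inter> D0))) ` sets N)"
      by auto
    fix E :: "nat \<Rightarrow> 'a set" assume E: "range E \<subseteq> sets N" "disjoint_family E"
    have UE: "(\<Union>i. E i \<inter> D0) = D0 \<inter> (\<Union>i. E i)" by auto
    have "(\<Union>i. E i) \<in> sets N" using E(1) by auto
    then have fm: "(\<Union>i. E i \<inter> D0) \<in> fmeasurable N"
      unfolding UE by (rule fmeasurable_Int_fmeasurable[OF D0(1)])
    have "(\<lambda>i. g (E i \<inter> D0)) sums g (\<Union>i. E i \<inter> D0)"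
    proof (rule g_sums[OF _ _ fm])
      show "range (\<lambda>i. E i \<inter> D0) \<subseteq> sets N" using E(1) D0(1) by auto
      show "disjoint_family (\<lambda>i. E i \<inter> D0)"
        by (rule disjoint_family_on_bisimulation[OF E(2)]) auto
    qed
    then have "(\<lambda>n. ereal (\<Sum>i<n. g (E i \<inter> D0))) \<longlonglongrightarrow> ereal (g (\<Union>i. E i \<inter> D0))"
      by (simp add: sums_def)
    then show "(\<lambda>n. \<Sum>i<n. ereal (g (E i \<inter> D0))) \<longlonglongrightarrow> ereal (g ((\<Union>i. E i) \<inter> D0))"
      by simp
  qed
  obtain H where H: "H \<in> sets N" "\<And>B. \<lbrakk>B \<in> sets N; B \<subseteq> H\<rbrakk> \<Longrightarrow> ereal (g (B \<inter> D0)) \<le> 0"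
    "\<And>B. \<lbrakk>B \<in> sets N; B \<inter> H = {}\<rbrakk> \<Longrightarrow> 0 \<le> ereal (g (B \<inter> D0))"
    by (rule Hahn_decomposition_signed[OF sgn]) auto
  have bd: "\<bar>f x\<bar> \<le> g (D0 - H) - g (D0 \<inter> H)" if x: "0 \<le> x" "x \<le> c" for x
  proof -
    obtain B where B: "B \<in> fmeasurable N" "B \<subseteq> D0" "measure N B = x"
      using sub[OF D0(1), of x] x by (auto simp: c_def)
    have pos: "0 \<le> g C" if "C \<in> fmeasurable N" "C \<subseteq> D0 - H" for C
    proof -
      have "C \<inter> D0 = C" "C \<inter> H = {}" using that(2) by auto
      then show ?thesis using H(3)[of C] that(1) by auto
    qed
    have neg: "g C \<le> 0" if "C \<in> fmeasurable N" "C \<subseteq> D0 \<inter> H" for C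
    proof -
      have "C \<inter> D0 = C" "C \<subseteq> H" using that(2) by auto
      then show ?thesis using H(2)[of C] that(1) by auto
    qed
    have fm: "B - H \<in> fmeasurable N" "B \<inter> H \<in> fmeasurable N"
      "(D0 - B) - H \<in> fmeasurable N" "(D0 - B) \<inter> H \<in> fmeasurable N"
      using fmeasurable_Diff[OF _ H(1)] Int_fmeasurable[OF _ H(1)] B(1)
        fmeasurable_Diff[OF D0(1) fmeasurableD[OF B(1)]] by blast+
    have "g ((B - H) \<union> (B \<inter> H)) = g (B - H) + g (B \<inter> H)"
      "g ((B - H) \<union> ((D0 - B) - H)) = g (B - H) + g ((D0 - B) - H)"
      "g ((B \<inter> H) \<union> ((D0 - B) \<inter> H)) = g (B \<inter> H) + g ((D0 - B) \<inter> H)"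
      using fm by (intro g_Un; auto)+
    moreover have "(B - H) \<union> (B \<inter> H) = B" "(B - H) \<union> ((D0 - B) - H) = D0 - H"
      "(B \<inter> H) \<union> ((D0 - B) \<inter> H) = D0 \<inter> H" using B(2) by auto
    moreover have "0 \<le> g (B - H)" "0 \<le> g ((D0 - B) - H)" "g (B \<inter> H) \<le> 0" "g ((D0 - B) \<inter> H) \<le> 0"
      using fm B(2) by (intro pos neg; auto)+
    ultimately show ?thesis using f_measure[OF B(1)] B(3) by auto
  qed
  have "g B = f c / c * measure N B" if "B \<in> fmeasurable N" "measure N B \<le> c" for B
    using additive_bounded_linear[of c f _ "measure N B", OF \<open>0 < c\<close> add bd] f_measure that by simp
  then show ?thesis using that[OF \<open>0 < c\<close>] by blast
qed

text \<open>Apart from \<open>D\<close>, which is null, \<open>T\<close> has mass only on atoms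
  below \<epsilon>, and it meets such an atom in its full measure or not at all up to null sets. So
  the quotient bound holds on every piece and can be summed.\<close>

lemma G_bound:
  assumes "D \<in> null_sets N" and bound: "\<And>A. \<lbrakk>A \<in> F; measure N A < \<epsilon>\<rbrakk> \<Longrightarrow> \<bar>g A\<bar> \<le> K * measure N A"
    and T: "T \<in> fmeasurable N" "T \<subseteq> G \<epsilon>"
  shows "\<bar>g T\<bar> \<le> K * measure N T"
proof (rule g_bound[OF T(1)])
  have "T \<inter> D \<in> null_sets N" using null_set_Int1[OF assms(1), of T] T(1) by auto
  then have "T \<inter> D \<in> fmeasurable N" "measure N (T \<inter> D) = 0"
    by (auto simp: fmeasurableI_null_sets measure_eq_0_null_sets)
  then show "\<bar>g (T \<inter> D)\<bar> \<le> K * measure N (T \<inter> D)" using g_null by simp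
  fix A assume A: "A \<in> F"
  have fm: "T \<inter> A \<in> fmeasurable N" using Int_fmeasurable[OF T(1) F_sets[OF A]] .
  show "\<bar>g (T \<inter> A)\<bar> \<le> K * measure N (T \<inter> A)"
  proof (cases "measure N (T \<inter> A) = 0")
    case True then show ?thesis using g_null[OF fm] by simp
  next
    case False
    then have eq: "measure N (T \<inter> A) = measure N A" using atom_Int_cases[OF atom_F[OF A], of T] T(1) by auto
    have "measure N A < \<epsilon>"
    proof (rule ccontr)
      assume "\<not> measure N A < \<epsilon>"
      then have "T \<inter> A = {}" using A T(2) by (intro disjoint_part) (auto simp: G_def)
      then show False using False by simp
    qed
    then show ?thesis using bound[OF A] eq g_eq[OF fm F_fmeasurable[OF A]] by simp
  qed
qed

text \<open>\<open>u\<close> is attained inside \<open>G \<tau>\<close>, which is disjoint from the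
  atoms in \<open>Y\<close>.\<close>

lemma f_add_G:
  assumes "finite Y" "Y \<subseteq> F" "\<And>A. A \<in> Y \<Longrightarrow> \<tau> \<le> measure N A"
    and u: "0 \<le> u" "ennreal u \<le> emeasure N (G \<tau>)"
  shows "f (measure N (\<Union>Y) + u) = f (measure N (\<Union>Y)) + f u"
proof -
  obtain T where T: "T \<in> fmeasurable N" "T \<subseteq> G \<tau>" "measure N T = u" using G_attains[OF u] by blast
  have "T \<inter> A = {}" if "A \<in> Y" for A
    using T(2) that assms(2) assms(3)[OF that] by (intro disjoint_part[of T "{A\<in>F. measure N A < \<tau>}"])
      (auto simp: G_def)
  then have "\<Union>Y \<inter> T = {}" by blast
  from f_add[OF measure_Union_F(1)[OF assms(1,2)] T(1) this] T(3) show ?thesis by simp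
qed

lemma emeasure_G_null:
  assumes "D \<in> null_sets N"
  shows "emeasure N (G z) = emeasure N (\<Union>{A\<in>F. measure N A < z})"
  using emeasure_Un_null_set[OF Union_F_sets[of "{A\<in>F. measure N A < z}"] assms]
  by (auto simp: G_def Un_commute)

lemma G_mono: "z \<le> z' \<Longrightarrow> G z \<subseteq> G z'"
  by (fastforce simp: G_def)

lemma emeasure_G_pos:
  assumes "0 < emeasure N (space N)" "0 < z"
  shows "0 < emeasure N (G z)"
proof -
  obtain B where B: "B \<in> fmeasurable N" "emeasure N B > 0"
    using exists_fmeasurable_subset[OF sets.top assms(1)] by blast
  define r where "r = min (measure N B) z"
  have "0 < r" using B assms(2) by (simp add: r_def emeasure_eq_measure2)
  then have "ennreal r \<le> emeasure N (G r)"
    using le_space[OF B(1), of r] by (intro G_measure_ge) (auto simp: r_def)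
  moreover have "emeasure N (G r) \<le> emeasure N (G z)"
    using G_mono[of r z] G_sets by (intro emeasure_mono) (auto simp: r_def)
  ultimately show ?thesis using \<open>0 < r\<close>
    by (metis ennreal_less_zero_iff less_le_trans)
qed

text \<open>Common end of the finite and the infinite case. The points of \<open>R\<close> are the
  measures of unions of subfamilies of one finite family \<open>Y\<close>. Its atoms have measure at
  least \<open>\<tau>\<close>, and \<open>G \<tau>\<close> has measure at least \<open>s\<close>, so
  every \<open>u \<le> s\<close> can be added disjointly.\<close>

lemma local_linear_copies:
  assumes D: "D \<in> null_sets N"
    and bound: "\<And>A. \<lbrakk>A \<in> F; measure N A < \<epsilon>\<rbrakk> \<Longrightarrow> \<bar>g A\<bar> \<le> K * measure N A"
    and "0 < x0" and x0: "ennreal x0 \<le> emeasure N (G \<epsilon>)"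
    and copies: "\<And>\<delta>. 0 < \<delta> \<Longrightarrow> \<exists>s Y \<tau>. 0 < s \<and> s < \<delta> \<and> finite Y \<and> Y \<subseteq> F \<and>
      (\<forall>A\<in>Y. \<tau> \<le> measure N A) \<and> ennreal s \<le> emeasure N (G \<tau>) \<and>
      (\<forall>x\<in>{0..x0}. \<exists>X\<subseteq>Y. measure N (\<Union>X) \<le> x \<and> x \<le> measure N (\<Union>X) + s)"
  obtains \<alpha> where "\<And>B. \<lbrakk>B \<in> fmeasurable N; measure N B \<le> x0\<rbrakk> \<Longrightarrow> g B = \<alpha> * measure N B"
proof -
  have fb: "\<bar>f t\<bar> \<le> K * t" if t: "0 \<le> t" "t \<le> x0" for t
  proof -
    have "ennreal t \<le> emeasure N (G \<epsilon>)" using x0 ennreal_leI[OF t(2)] by (rule order_trans[rotated])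
    then obtain T where T: "T \<in> fmeasurable N" "T \<subseteq> G \<epsilon>" "measure N T = t"
      using G_attains t(1) by blast
    then show ?thesis using G_bound[OF D bound T(1,2)] f_measure[OF T(1)] by simp
  qed
  have cp: "\<exists>s R. 0 < s \<and> s < \<delta> \<and> finite R \<and> R \<subseteq> {0..} \<and>
        (\<forall>x\<in>{0..x0}. \<exists>y\<in>R. y \<le> x \<and> x \<le> y + s) \<and>
        (\<forall>y\<in>R. \<forall>u. 0 \<le> u \<and> u \<le> s \<and> y + u \<le> x0 \<longrightarrow> f (y + u) = f y + f u)"
    if \<delta>: "0 < \<delta>" for \<delta>
  proof -
    obtain s Y \<tau> where s: "0 < s" "s < \<delta>" and Y: "finite Y" "Y \<subseteq> F" "\<And>A. A \<in> Y \<Longrightarrow> \<tau> \<le> measure N A"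
      and G: "ennreal s \<le> emeasure N (G \<tau>)"
      and cover: "\<And>x. \<lbrakk>0 \<le> x; x \<le> x0\<rbrakk> \<Longrightarrow> \<exists>X\<subseteq>Y. measure N (\<Union>X) \<le> x \<and> x \<le> measure N (\<Union>X) + s"
      using copies[OF \<delta>] by (metis atLeastAtMost_iff)
    define R where "R = (\<lambda>X. measure N (\<Union>X)) ` Pow Y"
    have "f (y + u) = f y + f u" if y: "y \<in> R" and u: "0 \<le> u" "u \<le> s" for y u
    proof -
      obtain X where X: "X \<subseteq> Y" "y = measure N (\<Union>X)" using y by (auto simp: R_def)
      have "ennreal u \<le> emeasure N (G \<tau>)" using G ennreal_leI[OF u(2)] by (rule order_trans[rotated])
      moreover have "finite X" "X \<subseteq> F" using X Y finite_subset by auto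
      moreover have "\<tau> \<le> measure N A" if "A \<in> X" for A using X(1) Y(3) that by blast
      ultimately show ?thesis using f_add_G[of X \<tau> u] u(1) X(2) by simp
    qed
    moreover have "finite R" "R \<subseteq> {0..}" using Y(1) by (auto simp: R_def)
    moreover have "\<exists>y\<in>R. y \<le> x \<and> x \<le> y + s" if "x \<in> {0..x0}" for x
      using cover[of x] that by (force simp: R_def)
    ultimately show ?thesis using s by (intro exI[of _ s] exI[of _ R]) simp
  qed
  obtain \<alpha> where \<alpha>: "\<And>t. \<lbrakk>0 \<le> t; t \<le> x0\<rbrakk> \<Longrightarrow> f t = \<alpha> * t"
    using linear_of_scaled_copies[OF \<open>0 < x0\<close> fb cp] by blast
  show ?thesis
  proof (rule that)
    fix B assume "B \<in> fmeasurable N" "measure N B \<le> x0"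
    then show "g B = \<alpha> * measure N B" using \<alpha>[of "measure N B"] f_measure by simp
  qed
qed

text \<open>Since \<open>G \<epsilon>\<close> has finite measure, the tails \<open>G \<tau>\<close>
  shrink in measure to the null set \<open>D\<close>, and only finitely many atoms have measure
  between \<open>\<tau>\<close> and \<epsilon>. A subset of \<open>G \<epsilon>\<close> consists, up
  to null sets, of some of these atoms and a part of \<open>G \<tau>\<close>, whose measure is the
  scale \<open>s\<close>.\<close>

lemma local_linear_finite:
  assumes D: "D \<in> null_sets N" and pos: "0 < emeasure N (space N)" and "0 < \<epsilon>"
    and bound: "\<And>A. \<lbrakk>A \<in> F; measure N A < \<epsilon>\<rbrakk> \<Longrightarrow> \<bar>g A\<bar> \<le> K * measure N A"
    and fin: "G \<epsilon> \<in> fmeasurable N"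
  obtains \<alpha> where "0 < measure N (G \<epsilon>)"
    "\<And>B. \<lbrakk>B \<in> fmeasurable N; measure N B \<le> measure N (G \<epsilon>)\<rbrakk> \<Longrightarrow> g B = \<alpha> * measure N B"
proof -
  define x0 where "x0 = measure N (G \<epsilon>)"
  have Gfm: "G z \<in> fmeasurable N" if "z \<le> \<epsilon>" for z
    using G_mono[OF that] G_sets fin by (blast intro: fmeasurableI2)
  have Gpos: "0 < measure N (G z)" if "0 < z" "z \<le> \<epsilon>" for z
    using emeasure_G_pos[OF pos that(1)] Gfm[OF that(2)] by (simp add: emeasure_eq_measure2)
  have "0 < x0" using Gpos \<open>0 < \<epsilon>\<close> by (simp add: x0_def)
  define A where "A n = G (\<epsilon> / real (Suc n))" for n
  have Ale: "\<epsilon> / real (Suc n) \<le> \<epsilon>" for n using \<open>0 < \<epsilon>\<close> by (simp add: divide_le_eq)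
  have "(\<Inter>n. A n) = D"
  proof (intro equalityI subsetI)
    fix x assume x: "x \<in> (\<Inter>n. A n)"
    show "x \<in> D"
    proof (rule ccontr)
      assume "x \<notin> D"
      then have "\<exists>B\<in>F. x \<in> B \<and> measure N B < \<epsilon> / real (Suc n)" for n
        using x by (auto simp: A_def G_def)
      \<comment> \<open>Disjointness makes the atom containing \<open>x\<close> the same for every
        \<open>n\<close>, so its positive measure would lie below all
        \<open>\<epsilon> / real (Suc n)\<close>.\<close>
      then obtain B where B: "B \<in> F" "x \<in> B" and all: "\<And>n. \<exists>C\<in>F. x \<in> C \<and> measure N C < \<epsilon> / real (Suc n)"
        by blast
      have "measure N B < \<epsilon> / real (Suc n)" for n
        using all[of n] F_Int[OF B(1)] B(2) by blast
      then have "real (Suc n) * measure N B < \<epsilon>" for n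
        by (simp add: pos_less_divide_eq mult.commute)
      then have "real n * measure N B < \<epsilon>" for n
        using F_pos[OF B(1)] by (smt (verit) mult_right_mono of_nat_Suc)
      moreover obtain n where "\<epsilon> < real n * measure N B"
        using reals_Archimedean3[OF F_pos[OF B(1)]] by blast
      ultimately show False by (meson less_asym)
    qed
  qed (auto simp: A_def G_def)
  moreover have "(\<lambda>n. measure N (A n)) \<longlonglongrightarrow> measure N (\<Inter>n. A n)"
  proof (rule Lim_measure_decseq)
    show "range A \<subseteq> sets N" using G_sets by (auto simp: A_def)
    show "decseq A"
      unfolding A_def using \<open>0 < \<epsilon>\<close> by (intro decseq_SucI G_mono) (auto simp: field_simps)
    show "emeasure N (A i) \<noteq> \<infinity>" for i using Gfm[OF Ale] by (simp add: A_def emeasure_eq_measure2)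
  qed
  ultimately have lim: "(\<lambda>n. measure N (A n)) \<longlonglongrightarrow> 0"
    using D by (simp add: measure_eq_0_null_sets)
  have copies: "\<exists>s Y \<tau>. 0 < s \<and> s < \<delta> \<and> finite Y \<and> Y \<subseteq> F \<and>
      (\<forall>A\<in>Y. \<tau> \<le> measure N A) \<and> ennreal s \<le> emeasure N (G \<tau>) \<and>
      (\<forall>x\<in>{0..x0}. \<exists>X\<subseteq>Y. measure N (\<Union>X) \<le> x \<and> x \<le> measure N (\<Union>X) + s)" if \<delta>: "0 < \<delta>" for \<delta>
  proof -
    have "eventually (\<lambda>n. measure N (A n) < \<delta>) sequentially" using lim \<delta> by (rule order_tendstoD)
    then obtain n where n: "measure N (A n) < \<delta>" by (auto simp: eventually_sequentially)
    define \<tau> where "\<tau> = \<epsilon> / real (Suc n)"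
    have \<tau>: "0 < \<tau>" "\<tau> \<le> \<epsilon>" using \<open>0 < \<epsilon>\<close> Ale[of n] by (auto simp: \<tau>_def)
    define s where "s = measure N (G \<tau>)"
    have s: "0 < s" "s < \<delta>" using Gpos[OF \<tau>] n by (auto simp: s_def \<tau>_def A_def)
    define Y where "Y = {B\<in>F. \<tau> \<le> measure N B \<and> measure N B < \<epsilon>}"
    have YF: "Y \<subseteq> F" by (auto simp: Y_def)
    have YG: "\<Union>X \<subseteq> G \<epsilon>" if "X \<subseteq> Y" for X using that by (auto simp: Y_def G_def)
    have finY: "finite Y"
    proof (rule ccontr)
      assume inf: "infinite Y"
      obtain k where k: "x0 < real k * \<tau>" using reals_Archimedean3[OF \<tau>(1)] by blast
      obtain X where X: "X \<subseteq> Y" "finite X" "card X = k"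
        using infinite_arbitrarily_large[OF inf] by blast
      have XF: "X \<subseteq> F" using X(1) YF by blast
      have "real k * \<tau> = (\<Sum>B\<in>X. \<tau>)" using X by simp
      also have "\<dots> \<le> (\<Sum>B\<in>X. measure N B)" using X(1) by (intro sum_mono) (auto simp: Y_def)
      also have "\<dots> = measure N (\<Union>X)" using measure_Union_F[OF X(2) XF] by simp
      also have "\<dots> \<le> x0"
        unfolding x0_def using YG[OF X(1)] Union_F_sets[OF XF] fin by (intro measure_mono_fmeasurable)
      finally show False using k by simp
    qed
    have cover: "\<exists>X\<subseteq>Y. measure N (\<Union>X) \<le> x \<and> x \<le> measure N (\<Union>X) + s"
      if x: "0 \<le> x" "x \<le> x0" for x
    proof -
      have "ennreal x \<le> emeasure N (G \<epsilon>)"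
        using x fin by (simp add: x0_def emeasure_eq_measure2 ennreal_leI)
      then obtain T where T: "T \<in> fmeasurable N" "T \<subseteq> G \<epsilon>" "measure N T = x"
        using G_attains x(1) by blast
      \<comment> \<open>Each atom of \<open>Y\<close> lies in \<open>T\<close> up to a null set or
        meets it in a null set; \<open>X\<close> collects the former.\<close>
      define X where "X = {B\<in>Y. measure N (T \<inter> B) \<noteq> 0}"
      have XY: "X \<subseteq> Y" and XF: "X \<subseteq> F" and finX: "finite X" using YF finY by (auto simp: X_def)
      have TB: "T \<inter> B \<in> fmeasurable N" if "B \<in> Y" for B
        using Int_fmeasurable[OF T(1)] F_sets YF that by blast
      have dis: "disjoint_family_on (\<lambda>B. T \<inter> B) Y"
        unfolding disjoint_family_on_def using F_Int YF by blast
      have "measure N (\<Union>B\<in>Y. T \<inter> B) = (\<Sum>B\<in>Y. measure N (T \<inter> B))"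
        using finY dis TB by (intro measure_finite_Union) (auto simp: emeasure_eq_measure2 dest: TB)
      also have "\<dots> = (\<Sum>B\<in>X. measure N (T \<inter> B))"
        using finY by (intro sum.mono_neutral_right) (auto simp: X_def)
      also have "\<dots> = (\<Sum>B\<in>X. measure N B)"
      proof (rule sum.cong)
        fix B assume "B \<in> X"
        then show "measure N (T \<inter> B) = measure N B"
          using atom_Int_cases[OF atom_F, of B T] XF T(1) by (auto simp: X_def)
      qed simp
      also have "\<dots> = measure N (\<Union>X)" using measure_Union_F[OF finX XF] by simp
      finally have mX: "measure N (T \<inter> \<Union>Y) = measure N (\<Union>X)" by (simp add: Int_UN_distrib)
      have fmY: "T \<inter> \<Union>Y \<in> fmeasurable N" using Int_fmeasurable[OF T(1) Union_F_sets[OF YF]] .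
      have fmG: "T \<inter> G \<tau> \<in> fmeasurable N" using Int_fmeasurable[OF T(1) G_sets] .
      have "G \<tau> \<inter> \<Union>Y = {}"
      proof -
        have "G \<tau> \<inter> B = {}" if "B \<in> Y" for B
          using that by (intro disjoint_part[of _ "{A\<in>F. measure N A < \<tau>}"]) (auto simp: G_def Y_def)
        then show ?thesis by blast
      qed
      moreover have "G \<epsilon> \<subseteq> \<Union>Y \<union> G \<tau>"
      proof -
        have "B \<subseteq> \<Union>Y \<union> G \<tau>" if "B \<in> F" "measure N B < \<epsilon>" for B
          using that by (cases "measure N B < \<tau>") (auto simp: G_def Y_def not_less)
        then show ?thesis by (auto simp: G_def)
      qed
      ultimately have "T = (T \<inter> \<Union>Y) \<union> (T \<inter> G \<tau>)" "(T \<inter> \<Union>Y) \<inter> (T \<inter> G \<tau>) = {}"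
        using T(2) by auto
      then have "x = measure N (\<Union>X) + measure N (T \<inter> G \<tau>)"
        using measure_Un_fmeasurable[OF fmY fmG] T(3) mX by metis
      moreover have "measure N (T \<inter> G \<tau>) \<le> s"
        unfolding s_def using fmG Gfm[OF \<tau>(2)] by (intro measure_mono_fmeasurable) auto
      ultimately show ?thesis using XY by (intro exI[of _ X]) simp
    qed
    have "ennreal s \<le> emeasure N (G \<tau>)" using Gfm[OF \<tau>(2)] by (simp add: s_def emeasure_eq_measure2)
    moreover have "\<forall>A\<in>Y. \<tau> \<le> measure N A" by (simp add: Y_def)
    ultimately show ?thesis using s finY YF cover
      by (intro exI[of _ s] exI[of _ Y] exI[of _ \<tau>]) auto
  qed
  have "ennreal x0 \<le> emeasure N (G \<epsilon>)" using fin by (simp add: x0_def emeasure_eq_measure2)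
  then obtain \<alpha> where "\<And>B. \<lbrakk>B \<in> fmeasurable N; measure N B \<le> x0\<rbrakk> \<Longrightarrow> g B = \<alpha> * measure N B"
    using local_linear_copies[OF D bound \<open>0 < x0\<close> _ copies] by blast
  then show ?thesis using that \<open>0 < x0\<close> unfolding x0_def by blast
qed

text \<open>Finitely many atoms below the scale \<open>s\<close> already have total measure above 1,
  and a greedy selection among them approximates every \<open>x \<le> 1\<close> from below within
  \<open>s\<close>. With \<open>\<tau>\<close> the least measure of the chosen atoms, the infinite
  measure of \<open>G \<tau>\<close> leaves room for \<open>s\<close>. The bound 1 is an arbitrary
  choice.\<close>

lemma local_linear_infinite:
  assumes D: "D \<in> null_sets N"
    and bound: "\<And>A. \<lbrakk>A \<in> F; measure N A < \<epsilon>\<rbrakk> \<Longrightarrow> \<bar>g A\<bar> \<le> K * measure N A" and "0 < \<epsilon>"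
    and inf: "\<And>z. 0 < z \<Longrightarrow> emeasure N (G z) = \<infinity>"
  obtains \<alpha> where "\<And>B. \<lbrakk>B \<in> fmeasurable N; measure N B \<le> 1\<rbrakk> \<Longrightarrow> g B = \<alpha> * measure N B"
proof -
  have copies: "\<exists>s Y \<tau>. 0 < s \<and> s < \<delta> \<and> finite Y \<and> Y \<subseteq> F \<and>
      (\<forall>A\<in>Y. \<tau> \<le> measure N A) \<and> ennreal s \<le> emeasure N (G \<tau>) \<and>
      (\<forall>x\<in>{0..1}. \<exists>X\<subseteq>Y. measure N (\<Union>X) \<le> x \<and> x \<le> measure N (\<Union>X) + s)" if \<delta>: "0 < \<delta>" for \<delta>
  proof -
    define s where "s = \<delta> / 2"
    have s: "0 < s" "s < \<delta>" using \<delta> by (auto simp: s_def)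
    have "ennreal 1 < emeasure N (\<Union>{A\<in>F. measure N A < s})"
      using inf[OF s(1)] emeasure_G_null[OF D, of s] by simp
    then obtain Y where Y: "finite Y" "Y \<subseteq> {A\<in>F. measure N A < s}" "1 < (\<Sum>A\<in>Y. measure N A)"
      using finite_atoms_exceed[of "{A\<in>F. measure N A < s}" 1] by blast
    have "Y \<noteq> {}" using Y(3) by auto
    define \<tau> where "\<tau> = Min (measure N ` Y)"
    have \<tau>: "\<tau> \<le> measure N A" if "A \<in> Y" for A using Y(1) that by (simp add: \<tau>_def)
    have "\<tau> \<in> measure N ` Y" unfolding \<tau>_def using Y(1) \<open>Y \<noteq> {}\<close> by (intro Min_in) auto
    then have "0 < \<tau>" using Y(2) F_pos by auto
    have cover: "\<exists>X\<subseteq>Y. measure N (\<Union>X) \<le> x \<and> x \<le> measure N (\<Union>X) + s" if x: "0 \<le> x" "x \<le> 1" for x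
    proof -
      obtain X B where X: "X \<subseteq> Y" "(\<Sum>A\<in>X. measure N A) \<le> x" "B \<in> Y" "x < (\<Sum>A\<in>X. measure N A) + measure N B"
        using greedy_atoms[of Y x "measure N"] Y(1,3) x by (metis le_less_trans)
      have "finite X" "X \<subseteq> F" using X(1) Y finite_subset by blast+
      then show ?thesis using X Y(2) measure_Union_F[of X] by (intro exI[of _ X]) auto
    qed
    then show ?thesis using s Y \<tau> inf[OF \<open>0 < \<tau>\<close>]
      by (intro exI[of _ s] exI[of _ Y] exI[of _ \<tau>]) auto
  qed
  have "ennreal 1 \<le> emeasure N (G \<epsilon>)" using inf[OF \<open>0 < \<epsilon>\<close>] by simp
  then show ?thesis using local_linear_copies[OF D bound zero_less_one _ copies] that by blast
qed

lemma local_linear: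
  assumes pos: "0 < emeasure N (space N)" and "0 < \<epsilon>"
    and bound: "\<And>A. \<lbrakk>A \<in> F; measure N A < \<epsilon>\<rbrakk> \<Longrightarrow> \<bar>g A\<bar> \<le> K * measure N A"
  shows "\<exists>x0 \<alpha>. 0 < x0 \<and> (\<forall>B\<in>fmeasurable N. measure N B \<le> x0 \<longrightarrow> g B = \<alpha> * measure N B)"
proof (cases "emeasure N D > 0")
  case True
  from local_linear_atomless[OF this]
  obtain x0 \<alpha> where "0 < x0" "\<And>B. \<lbrakk>B \<in> fmeasurable N; measure N B \<le> x0\<rbrakk> \<Longrightarrow> g B = \<alpha> * measure N B"
    by blast
  then show ?thesis by (intro exI[of _ x0] exI[of _ \<alpha>]) simp
next
  case False
  then have D: "D \<in> null_sets N" using D_sets by (auto simp: null_sets_def)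
  show ?thesis
  proof (cases "\<exists>z>0. emeasure N (G z) \<noteq> \<infinity>")
    case True
    then obtain z where z: "0 < z" "emeasure N (G z) \<noteq> \<infinity>" by blast
    \<comment> \<open>Small enough for both purposes: \<open>G z'\<close> has finite measure, and
      its atoms obey the quotient bound.\<close>
    define z' where "z' = min z \<epsilon>"
    have "0 < z'" using z(1) \<open>0 < \<epsilon>\<close> by (simp add: z'_def)
    have "G z \<in> fmeasurable N" using z(2) G_sets by (simp add: fmeasurable_def less_top)
    moreover have "G z' \<subseteq> G z" by (rule G_mono) (simp add: z'_def)
    ultimately have fin: "G z' \<in> fmeasurable N" using G_sets by (rule fmeasurableI2)
    have bound': "\<bar>g A\<bar> \<le> K * measure N A" if "A \<in> F" "measure N A < z'" for A
      using bound that by (simp add: z'_def)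
    from local_linear_finite[OF D pos \<open>0 < z'\<close> bound' fin]
    obtain \<alpha> where "0 < measure N (G z')"
      "\<And>B. \<lbrakk>B \<in> fmeasurable N; measure N B \<le> measure N (G z')\<rbrakk> \<Longrightarrow> g B = \<alpha> * measure N B"
      by blast
    then show ?thesis by (intro exI[of _ "measure N (G z')"] exI[of _ \<alpha>]) simp
  next
    case False
    then have "\<And>z. 0 < z \<Longrightarrow> emeasure N (G z) = \<infinity>" by blast
    from local_linear_infinite[OF D bound \<open>0 < \<epsilon>\<close> this]
    obtain \<alpha> where "\<And>B. \<lbrakk>B \<in> fmeasurable N; measure N B \<le> 1\<rbrakk> \<Longrightarrow> g B = \<alpha> * measure N B"
      by blast
    then show ?thesis by (intro exI[of _ 1] exI[of _ \<alpha>]) simp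
  qed
qed

section \<open>The linear formula on all sets of finite measure\<close>

lemma linear_on_fmeasurable:
  assumes pos: "0 < emeasure N (space N)" and "0 < \<epsilon>"
    and bound: "\<And>A. \<lbrakk>A \<in> F; measure N A < \<epsilon>\<rbrakk> \<Longrightarrow> \<bar>g A\<bar> \<le> K * measure N A"
  shows "\<exists>\<alpha>. \<forall>B\<in>fmeasurable N. g B = \<alpha> * measure N B"
proof -
  obtain x0 \<alpha> where \<alpha>: "0 < x0" "\<And>B. \<lbrakk>B \<in> fmeasurable N; measure N B \<le> x0\<rbrakk> \<Longrightarrow> g B = \<alpha> * measure N B"
    using local_linear[OF assms] by blast
  \<comment> \<open>Subtracting a multiple of the measure preserves every property required by the
    locale, so \<open>g_vanishes\<close> applies to the difference.\<close>
  interpret diff: atomic_partition N "\<lambda>A. g A - \<alpha> * measure N A" F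
  proof unfold_locales
    fix E :: "nat \<Rightarrow> 'a set"
    assume E: "range E \<subseteq> sets N" "disjoint_family E" "(\<Union>i. E i) \<in> fmeasurable N"
    then have "emeasure N (\<Union>i. E i) \<noteq> \<infinity>" by (simp add: emeasure_eq_measure2)
    then show "(\<lambda>i. g (E i) - \<alpha> * measure N (E i)) sums (g (\<Union>i. E i) - \<alpha> * measure N (\<Union>i. E i))"
      using measure_UNION[OF E(1,2)] g_sums[OF E] by (intro sums_diff sums_mult) auto
  next
    fix A B assume "A \<in> fmeasurable N" "B \<in> fmeasurable N" "measure N A = measure N B"
    then show "g A - \<alpha> * measure N A = g B - \<alpha> * measure N B" using g_eq[of A B] by simp
  qed (fact attained countable_F disjoint_F atom_F no_atom)+
  have "g B - \<alpha> * measure N B = 0" if "B \<in> fmeasurable N" for B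
    using diff.g_vanishes[OF \<alpha>(1) _ that] \<alpha>(2) by simp
  then show ?thesis by (intro exI[of _ \<alpha>]) simp
qed

end

lemma (in measure_determined) linear_if_bounded_on_small_atoms:
  assumes "0 < \<epsilon>"
    and bound: "\<And>A. \<lbrakk>measure_atom N A; measure N A < \<epsilon>\<rbrakk> \<Longrightarrow> \<bar>g A\<bar> \<le> K * measure N A"
  shows "\<exists>\<alpha>. \<forall>B\<in>fmeasurable N. g B = \<alpha> * measure N B"
proof (cases "0 < emeasure N (space N)")
  case True
  obtain F where F: "countable F" "disjoint F" "\<And>A. A \<in> F \<Longrightarrow> measure_atom N A"
    "\<And>B. B \<subseteq> space N - \<Union>F \<Longrightarrow> \<not> measure_atom N B"
    using maximal_disjoint_atoms by blast
  interpret atomic_partition N g F by unfold_locales (use F in auto)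
  show ?thesis using linear_on_fmeasurable[OF True \<open>0 < \<epsilon>\<close> bound[OF F(3)]] .
next
  case False
  have "measure N B = 0" if "B \<in> fmeasurable N" for B
    using emeasure_space[of N B] False that by (simp add: emeasure_eq_measure2)
  then show ?thesis using g_null by (intro exI[of _ 0]) simp
qed

section \<open>Reduction of signed to positive measures\<close>

lemma signed_measure_Union:
  assumes mu: "signed_measure M mu" and P: "finite P" "P \<subseteq> sets M" "disjoint P"
  shows "mu (\<Union>P) = (\<Sum>B\<in>P. mu B)"
  using P
proof (induction P rule: finite_induct)
  case empty then show ?case using signed_measure_empty[OF mu] by simp
next
  case (insert A P)
  have dis: "disjoint P" using insert.prems(2) by (simp add: pairwise_insert)
  have "A \<inter> B = {}" if "B \<in> P" for B
    using disjointD[OF insert.prems(2), of A B] insert.hyps(2) that by auto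
  then have "A \<inter> \<Union>P = {}" by blast
  then have "mu (A \<union> \<Union>P) = mu A + mu (\<Union>P)"
    using insert.prems(1) insert.hyps(1) by (intro signed_measure_Un[OF mu]) auto
  then show ?case using insert dis by simp
qed

text \<open>With -\<infinity> excluded, \<open>mu\<close> is finite on every measurable subset of
  \<open>H\<close>; this keeps the differences below meaningful in \<open>ereal\<close>.\<close>

locale Hahn_decomposed =
  fixes M :: "'a measure" and mu :: "'a set \<Rightarrow> ereal" and H :: "'a set"
  assumes mu: "signed_measure M mu" and no_MInf: "- \<infinity> \<notin> mu ` sets M"
    and H: "H \<in> sets M"
    and negative: "\<lbrakk>B \<in> sets M; B \<subseteq> H\<rbrakk> \<Longrightarrow> mu B \<le> 0"
    and positive: "\<lbrakk>B \<in> sets M; B \<inter> H = {}\<rbrakk> \<Longrightarrow> 0 \<le> mu B"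
begin

definition var :: "'a set \<Rightarrow> ereal" where "var A = mu (A - H) + - mu (A \<inter> H)"

lemma parts:
  assumes "A \<in> sets M"
  shows "0 \<le> mu (A - H)" "0 \<le> - mu (A \<inter> H)" "mu A = mu (A - H) + mu (A \<inter> H)" "\<bar>mu (A \<inter> H)\<bar> \<noteq> \<infinity>"
proof -
  show "0 \<le> mu (A - H)" using assms H by (intro positive) auto
  have neg: "mu (A \<inter> H) \<le> 0" using assms H by (intro negative) auto
  then show "0 \<le> - mu (A \<inter> H)" by simp
  have "A \<inter> H \<in> sets M" using assms H by auto
  then have "mu (A \<inter> H) \<noteq> - \<infinity>" using no_MInf by (metis image_eqI)
  then show "\<bar>mu (A \<inter> H)\<bar> \<noteq> \<infinity>" using neg by (cases "mu (A \<inter> H)") auto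
  have "(A - H) \<union> (A \<inter> H) = A" by auto
  then show "mu A = mu (A - H) + mu (A \<inter> H)"
    using signed_measure_Un[OF mu, of "A - H" "A \<inter> H"] assms H by auto
qed

lemma var_nonneg: "A \<in> sets M \<Longrightarrow> 0 \<le> var A"
  using parts[of A] by (simp add: var_def)

lemma abs_le_var: "A \<in> sets M \<Longrightarrow> \<bar>mu A\<bar> \<le> var A"
  using parts[of A] unfolding var_def by (cases "mu (A - H)"; cases "mu (A \<inter> H)") auto

lemma signed_measure_var: "signed_measure M var"
  unfolding signed_measure_def countably_additive_signed_def
proof (intro conjI allI impI)
  show "var {} = 0" using signed_measure_empty[OF mu] by (simp add: var_def)
  show "\<not> (\<infinity> \<in> var ` sets M \<and> - \<infinity> \<in> var ` sets M)"
  proof -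
    have "var A \<noteq> - \<infinity>" if "A \<in> sets M" for A using var_nonneg[OF that] by auto
    then show ?thesis by force
  qed
  fix E :: "nat \<Rightarrow> 'a set" assume E: "range E \<subseteq> sets M" "disjoint_family E"
  have E_sets: "E i \<in> sets M" for i using E by auto
  have UN: "(\<Union>i. E i) \<in> sets M" using E by auto
  have "(\<lambda>n. \<Sum>i<n. mu (E i - H)) \<longlonglongrightarrow> mu (\<Union>i. E i - H)"
    using E H by (intro signed_measure_LIMSEQ[OF mu] disjoint_family_on_bisimulation[OF E(2)]) auto
  moreover have "(\<lambda>n. \<Sum>i<n. - mu (E i \<inter> H)) \<longlonglongrightarrow> - mu (\<Union>i. E i \<inter> H)"
    using E H by (intro signed_measure_LIMSEQ[OF signed_measure_uminus[OF mu]]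
      disjoint_family_on_bisimulation[OF E(2)]) auto
  moreover have "(\<Union>i. E i - H) = (\<Union>i. E i) - H" "(\<Union>i. E i \<inter> H) = (\<Union>i. E i) \<inter> H" by auto
  \<comment> \<open>Finiteness of one limit permits adding the two limits in
    \<open>ereal\<close>.\<close>
  moreover have "\<bar>- mu ((\<Union>i. E i) \<inter> H)\<bar> \<noteq> \<infinity>" using parts(4)[OF UN] by simp
  ultimately have "(\<lambda>n. (\<Sum>i<n. mu (E i - H)) + (\<Sum>i<n. - mu (E i \<inter> H))) \<longlonglongrightarrow>
      mu ((\<Union>i. E i) - H) + - mu ((\<Union>i. E i) \<inter> H)"
    by (intro tendsto_add_ereal_general1) simp_all
  then show "(\<lambda>n. \<Sum>i<n. var (E i)) \<longlonglongrightarrow> var (\<Union>i. E i)"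
    by (simp add: var_def sum.distrib)
qed

text \<open>No partition exceeds \<open>var A\<close>, because
  \<open>\<bar>mu B\<bar> \<le> var B\<close> and \<open>var\<close> is additive; the partition into
  \<open>A - H\<close> and \<open>A \<inter> H\<close> attains it.\<close>

lemma total_variation_eq:
  assumes A: "A \<in> sets M"
  shows "total_variation M mu A = var A"
  unfolding total_variation_def
proof (rule antisym)
  show "(SUP P \<in> {P. finite P \<and> P \<subseteq> sets M \<and> disjoint P \<and> \<Union>P = A}. \<Sum>B\<in>P. \<bar>mu B\<bar>) \<le> var A"
  proof (rule SUP_least)
    fix P assume "P \<in> {P. finite P \<and> P \<subseteq> sets M \<and> disjoint P \<and> \<Union>P = A}"
    then have P: "finite P" "P \<subseteq> sets M" "disjoint P" "\<Union>P = A" by auto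
    have "(\<Sum>B\<in>P. \<bar>mu B\<bar>) \<le> (\<Sum>B\<in>P. var B)" using P(2) abs_le_var by (intro sum_mono) auto
    also have "\<dots> = var A" using signed_measure_Union[OF signed_measure_var P(1-3)] P(4) by simp
    finally show "(\<Sum>B\<in>P. \<bar>mu B\<bar>) \<le> var A" .
  qed
  define P where "P = {A - H, A \<inter> H}"
  have "var A = (\<Sum>B\<in>P. var B)"
  proof -
    have "disjoint P" by (auto simp: P_def disjoint_def)
    moreover have "\<Union>P = A" by (auto simp: P_def)
    ultimately show ?thesis
      using signed_measure_Union[OF signed_measure_var, of P] A H by (simp add: P_def)
  qed
  also have "\<dots> = (\<Sum>B\<in>P. \<bar>mu B\<bar>)"
  proof (rule sum.cong)
    fix B assume B: "B \<in> P"
    have "var (A - H) = \<bar>mu (A - H)\<bar>"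
    proof -
      have "A - H - H = A - H" "(A - H) \<inter> H = {}" by auto
      then show ?thesis
        using parts(1)[OF A] signed_measure_empty[OF mu] by (simp only: var_def) simp
    qed
    moreover have "var (A \<inter> H) = \<bar>mu (A \<inter> H)\<bar>"
    proof -
      have e: "A \<inter> H - H = {}" "A \<inter> H \<inter> H = A \<inter> H" by auto
      show ?thesis
        unfolding var_def e using parts(2)[OF A] signed_measure_empty[OF mu]
        by (cases "mu (A \<inter> H)") auto
    qed
    ultimately show "var B = \<bar>mu B\<bar>" using B by (auto simp: P_def)
  qed simp
  finally show "var A \<le> (SUP P \<in> {P. finite P \<and> P \<subseteq> sets M \<and> disjoint P \<and> \<Union>P = A}. \<Sum>B\<in>P. \<bar>mu B\<bar>)"
    using A H by (auto intro!: SUP_upper2[of P] simp: P_def disjoint_def)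
qed

section \<open>The variation as a positive measure\<close>

definition N :: "'a measure" where
  "N = measure_of (space M) (sets M) (\<lambda>A. e2ennreal (var A))"

lemma sets_N[simp]: "sets N = sets M" and space_N[simp]: "space N = space M"
  by (simp_all add: N_def)

lemma emeasure_N:
  assumes "A \<in> sets M"
  shows "emeasure N A = e2ennreal (var A)"
proof (rule emeasure_measure_of[OF N_def])
  show "sets M \<subseteq> Pow (space M)" by (rule sets.space_closed)
  show "positive (sets N) (\<lambda>A. e2ennreal (var A))"
    using signed_measure_empty[OF signed_measure_var] by (simp add: positive_def zero_ereal_def)
  show "countably_additive (sets N) (\<lambda>A. e2ennreal (var A))"
  proof (rule countably_additiveI)
    fix E :: "nat \<Rightarrow> 'a set" assume E: "range E \<subseteq> sets N" "disjoint_family E"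
    have "(\<lambda>n. \<Sum>i<n. var (E i)) \<longlonglongrightarrow> var (\<Union>i. E i)"
      using E by (intro signed_measure_LIMSEQ[OF signed_measure_var]) auto
    then have "(\<lambda>n. e2ennreal (\<Sum>i<n. var (E i))) \<longlonglongrightarrow> e2ennreal (var (\<Union>i. E i))"
      by (rule tendsto_e2ennrealI)
    moreover have "e2ennreal (\<Sum>i<n. var (E i)) = (\<Sum>i<n. e2ennreal (var (E i)))" for n
    proof (induction n)
      case (Suc n)
      have "e2ennreal (a + b) = e2ennreal a + e2ennreal b" if "0 \<le> a" "0 \<le> b" for a b :: ereal
        using that by (cases a; cases b) (auto simp: ennreal_plus)
      moreover have "E i \<in> sets M" for i using E by auto
      ultimately show ?case using Suc by (simp add: sum_nonneg var_nonneg)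
    qed (simp add: zero_ereal_def)
    ultimately have "(\<lambda>i. e2ennreal (var (E i))) sums e2ennreal (var (\<Union>i. E i))"
      by (simp add: sums_def)
    then show "(\<Sum>i. e2ennreal (var (E i))) = e2ennreal (var (\<Union>i. E i))" by (rule sums_unique[symmetric])
  qed
  show "A \<in> sets N" using assms by simp
qed

text \<open>The part inside \<open>H\<close> is always finite, so \<open>mu A\<close> and
  \<open>var A\<close> are infinite together, namely when \<open>mu (A - H)\<close> is.\<close>

lemma fmeasurable_N_iff: "A \<in> fmeasurable N \<longleftrightarrow> A \<in> sets M \<and> \<bar>mu A\<bar> \<noteq> \<infinity>"
proof -
  have "emeasure N A < \<infinity> \<longleftrightarrow> \<bar>mu A\<bar> \<noteq> \<infinity>" if "A \<in> sets M"
    using parts[OF that] emeasure_N[OF that] unfolding var_def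
    by (cases "mu (A - H)"; cases "mu (A \<inter> H)") auto
  then show ?thesis by (auto simp: fmeasurable_def)
qed

lemma measure_N:
  assumes "A \<in> fmeasurable N"
  shows "measure N A = real_of_ereal (mu (A - H)) - real_of_ereal (mu (A \<inter> H))"
proof -
  have A: "A \<in> sets M" "\<bar>mu A\<bar> \<noteq> \<infinity>" using assms by (auto simp: fmeasurable_N_iff)
  then show ?thesis
    using parts[OF A(1)] emeasure_N[OF A(1)] unfolding var_def measure_def
    by (cases "mu (A - H)"; cases "mu (A \<inter> H)") auto
qed

lemma sigma_finite_N:
  assumes "range C \<subseteq> sets M" "(\<Union>i::nat. C i) = space M" "\<And>i. total_variation M mu (C i) < \<infinity>"
  shows "sigma_finite_measure N"
proof
  have "emeasure N (C i) \<noteq> \<infinity>" for i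
  proof -
    have C: "C i \<in> sets M" using assms(1) by auto
    then have "var (C i) < \<infinity>" "0 \<le> var (C i)" using assms(3)[of i] var_nonneg total_variation_eq by auto
    then show ?thesis using emeasure_N[OF C] by (cases "var (C i)") auto
  qed
  then show "\<exists>A. countable A \<and> A \<subseteq> sets N \<and> \<Union>A = space N \<and> (\<forall>a\<in>A. emeasure N a \<noteq> \<infinity>)"
    using assms(1,2) by (intro exI[of _ "range C"]) auto
qed

lemma signed_atom_iff: "signed_atom M mu A \<longleftrightarrow> measure_atom N A"
proof -
  have eq: "emeasure N B = e2ennreal (total_variation M mu B)" "0 \<le> total_variation M mu B"
    if "B \<in> sets M" for B
    using emeasure_N[OF that] total_variation_eq[OF that] var_nonneg[OF that] by simp_all
  have pos: "0 < e2ennreal x \<longleftrightarrow> 0 < x" and zero: "e2ennreal x = 0 \<longleftrightarrow> x = 0" if "0 \<le> x" for x :: ereal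
    using that by (cases x; simp)+
  have inj: "e2ennreal x = e2ennreal y \<longleftrightarrow> x = y" if "0 \<le> x" "0 \<le> y" for x y :: ereal
    using that by (metis enn2ereal_e2ennreal)
  show ?thesis
  proof (cases "A \<in> sets M")
    case True
    have "(emeasure N B = 0 \<or> emeasure N B = emeasure N A) \<longleftrightarrow>
        (total_variation M mu B = 0 \<or> total_variation M mu B = total_variation M mu A)"
      if "B \<in> sets M" for B
      using eq[OF that] eq[OF True] by (simp add: zero inj)
    moreover have "0 < emeasure N A \<longleftrightarrow> 0 < total_variation M mu A" using eq[OF True] by (simp add: pos)
    ultimately show ?thesis using True by (simp add: signed_atom_def measure_atom_def)
  qed (simp add: signed_atom_def measure_atom_def)
qed

text \<open>Switching the part of a set inside \<open>H\<close> turns \<open>mu\<close> into its variation, up to a constant.\<close>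

definition flip :: "'a set \<Rightarrow> 'a set" where "flip A = (A - H) \<union> (H - A)"

lemma flip_parts: "flip A - H = A - H" "flip A \<inter> H = H - A" "flip (flip A) = A"
  by (auto simp: flip_def)

lemma flip_sets: "A \<in> sets M \<Longrightarrow> flip A \<in> sets M"
  using H by (auto simp: flip_def)

lemma flip_fmeasurable: "A \<in> fmeasurable N \<Longrightarrow> flip A \<in> fmeasurable N"
proof -
  assume A: "A \<in> fmeasurable N"
  have "H \<in> fmeasurable N" using parts(4)[OF H] H by (simp add: fmeasurable_N_iff)
  then show ?thesis
    unfolding flip_def using A by (intro fmeasurable.Un fmeasurable_Diff fmeasurableD)
qed

text \<open>Stated for a general \<open>nu\<close> so that it serves both measures. For
  \<open>mu\<close> it yields \<open>mu_flip\<close>; for the given \<open>nu\<close> it turns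
  condition L into the property that \<open>g\<close> depends on the measure alone.\<close>

lemma real_flip:
  assumes nu: "signed_measure M nu" and fin: "\<And>A. A \<in> fmeasurable N \<Longrightarrow> \<bar>nu A\<bar> \<noteq> \<infinity>"
    and A: "A \<in> fmeasurable N"
  shows "real_of_ereal (nu (flip A)) =
    real_of_ereal (nu H) + (real_of_ereal (nu (A - H)) - real_of_ereal (nu (A \<inter> H)))"
proof -
  have Hf: "H \<in> fmeasurable N" using parts(4)[OF H] H by (simp add: fmeasurable_N_iff)
  have fs: "flip A \<in> sets M" "A - H \<in> sets M" "A \<inter> H \<in> sets M" using A H flip_sets by (auto simp: fmeasurable_N_iff)
  have "flip A - (A - H) = H - (A \<inter> H)" by (auto simp: flip_def)
  moreover have "A - H \<subseteq> flip A" by (auto simp: flip_def)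
  ultimately have "real_of_ereal (nu (flip A)) =
      real_of_ereal (nu (A - H)) + real_of_ereal (nu (H - (A \<inter> H)))"
    using signed_measure_real_Diff[OF nu fs(1,2)] fin[OF flip_fmeasurable[OF A]] by simp
  moreover have "real_of_ereal (nu H) = real_of_ereal (nu (A \<inter> H)) + real_of_ereal (nu (H - (A \<inter> H)))"
    using signed_measure_real_Diff[OF nu H fs(3)] fin[OF Hf] by simp
  ultimately show ?thesis by simp
qed

lemma mu_flip:
  assumes A: "A \<in> fmeasurable N"
  shows "mu (flip A) = ereal (real_of_ereal (mu H) + measure N A)"
proof -
  have "\<bar>mu (flip A)\<bar> \<noteq> \<infinity>" using flip_fmeasurable[OF A] by (simp add: fmeasurable_N_iff)
  moreover have "real_of_ereal (mu (flip A)) = real_of_ereal (mu H) + measure N A"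
    using real_flip[OF mu _ A] measure_N[OF A] by (simp add: fmeasurable_N_iff)
  ultimately show ?thesis by (metis ereal_real')
qed

text \<open>\<open>mu H\<close> and \<open>mu (space M - H)\<close> are the extreme values of
  \<open>mu\<close> and differ by the total variation of the space. Hence \<open>mu H + x\<close>
  lies in the range, and exchanging inside \<open>H\<close> turns a set with this value into one of
  variation \<open>x\<close>.\<close>

lemma N_attained:
  assumes "ereal_interval (mu ` sets M)" and x: "0 \<le> x" "ennreal x \<le> emeasure N (space N)"
  shows "\<exists>A\<in>fmeasurable N. measure N A = x"
proof -
  have spH: "space M \<inter> H = H" using sets.sets_into_space[OF H] by auto
  define h where "h = real_of_ereal (mu H)"
  have h: "mu H = ereal h" using parts(4)[OF H] by (simp add: h_def ereal_real)
  have "ereal (h + x) \<le> mu (space M - H)"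
  proof (cases "mu (space M - H)")
    case (real v)
    have "0 \<le> v" "h \<le> 0" using parts(1,2)[OF sets.top] real h spH by auto
    moreover have "ennreal x \<le> ennreal (v - h)"
      using x(2) real h emeasure_N[OF sets.top] by (simp add: var_def spH)
    ultimately show ?thesis using x(1) real by (simp add: ennreal_le_iff)
  qed (use parts(1)[OF sets.top] in auto)
  moreover have "mu H \<le> ereal (h + x)" using x(1) h by simp
  moreover have "mu H \<in> mu ` sets M" "mu (space M - H) \<in> mu ` sets M" using H by auto
  ultimately have "ereal (h + x) \<in> mu ` sets M" using assms(1) unfolding ereal_interval_def by blast
  then obtain B where B: "B \<in> sets M" "mu B = ereal (h + x)" by force
  have "B \<in> fmeasurable N" using B by (simp add: fmeasurable_N_iff)
  then have A: "flip B \<in> fmeasurable N" by (rule flip_fmeasurable)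
  have "measure N (flip B) = x" using mu_flip[OF A] B(2) by (simp add: flip_parts h_def)
  then show ?thesis using A by blast
qed

lemma multiple_on_fmeasurable:
  assumes N: "sigma_finite_measure N" and int: "ereal_interval (mu ` sets M)"
    and nu: "signed_measure M nu" and L: "condition_L M mu nu" and "0 < \<epsilon>"
    and bound: "\<And>A. \<lbrakk>signed_atom M mu A; \<bar>mu A\<bar> < ereal \<epsilon>\<rbrakk> \<Longrightarrow> \<bar>nu A / mu A\<bar> < ereal K"
  shows "\<exists>\<alpha>. \<forall>A\<in>fmeasurable N. nu A = ereal (\<alpha> * real_of_ereal (mu A))"
proof -
  define m where "m A = real_of_ereal (mu A)" for A
  define q where "q A = real_of_ereal (nu A)" for A
  have mu_m: "mu A = ereal (m A)" if "A \<in> fmeasurable N" for A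
    using that by (simp add: fmeasurable_N_iff m_def ereal_real)
  have L': "nu A = nu B \<and> \<bar>nu A\<bar> \<noteq> \<infinity>"
    if "A \<in> fmeasurable N" "B \<in> fmeasurable N" "mu A = mu B" for A B
    using L[unfolded condition_L_def, rule_format, of A B] that by (auto simp: fmeasurable_N_iff)
  have fin: "\<bar>nu A\<bar> \<noteq> \<infinity>" if "A \<in> fmeasurable N" for A using L'[OF that that] by simp
  have nu_q: "nu A = ereal (q A)" if "A \<in> fmeasurable N" for A
    using fin[OF that] by (simp add: q_def ereal_real)
  have q_eq: "q A = q B" if "A \<in> fmeasurable N" "B \<in> fmeasurable N" "mu A = mu B" for A B
    using L'[OF that] by (simp add: q_def)
  have q0: "q {} = 0" using signed_measure_empty[OF nu] by (simp add: q_def)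
  have m0: "m {} = 0" using signed_measure_empty[OF mu] by (simp add: m_def)
  \<comment> \<open>\<open>nu\<close> with its sign reversed inside \<open>H\<close>, just as
    \<open>var\<close> is \<open>mu\<close> with its sign reversed there.\<close>
  define g where "g A = q (A - H) - q (A \<inter> H)" for A
  have DH: "A - H \<in> fmeasurable N" "A \<inter> H \<in> fmeasurable N" if "A \<in> fmeasurable N" for A
    using that H by (auto intro: fmeasurable_Diff fmeasurable_Int_fmeasurable)
  have split: "m A = m (A - H) + m (A \<inter> H)" "q A = q (A - H) + q (A \<inter> H)"
    if A: "A \<in> fmeasurable N" for A
  proof -
    have "A - (A \<inter> H) = A - H" by auto
    moreover have "A \<in> sets M" "A \<inter> H \<in> sets M" "\<bar>mu A\<bar> \<noteq> \<infinity>"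
      using A H by (auto simp: fmeasurable_N_iff)
    ultimately show "m A = m (A - H) + m (A \<inter> H)" "q A = q (A - H) + q (A \<inter> H)"
      using signed_measure_real_Diff[OF mu, of A "A \<inter> H"] signed_measure_real_Diff[OF nu, of A "A \<inter> H"]
        fin[OF A] by (auto simp: m_def q_def)
  qed
  interpret sigma_finite_measure N by fact
  interpret measure_determined N g
  proof unfold_locales
    fix E :: "nat \<Rightarrow> 'a set"
    assume E: "range E \<subseteq> sets N" "disjoint_family E" "(\<Union>i. E i) \<in> fmeasurable N"
    have U: "(\<Union>i. E i - H) = (\<Union>i. E i) - H" "(\<Union>i. E i \<inter> H) = (\<Union>i. E i) \<inter> H" by auto
    have "(\<lambda>i. q (E i - H)) sums q (\<Union>i. E i - H)"
      unfolding q_def using E(1) H fin[OF DH(1)[OF E(3)]] U(1)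
      by (intro signed_measure_sums[OF nu] disjoint_family_on_bisimulation[OF E(2)]) auto
    moreover have "(\<lambda>i. q (E i \<inter> H)) sums q (\<Union>i. E i \<inter> H)"
      unfolding q_def using E(1) H fin[OF DH(2)[OF E(3)]] U(2)
      by (intro signed_measure_sums[OF nu] disjoint_family_on_bisimulation[OF E(2)]) auto
    ultimately show "(\<lambda>i. g (E i)) sums g (\<Union>i. E i)"
      unfolding g_def U by (rule sums_diff)
  next
    fix A B assume AB: "A \<in> fmeasurable N" "B \<in> fmeasurable N" "measure N A = measure N B"
    have "q (flip A) = q (flip B)"
      using AB flip_fmeasurable mu_flip by (intro q_eq) auto
    then show "g A = g B" using real_flip[OF nu fin] AB by (simp add: g_def q_def)
  next
    fix x assume "0 \<le> x" "ennreal x \<le> emeasure N (space N)"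
    then show "\<exists>A\<in>fmeasurable N. measure N A = x" by (rule N_attained[OF int])
  qed
  have "\<bar>g A\<bar> \<le> K * measure N A" if A: "measure_atom N A" "measure N A < \<epsilon>" for A
  proof -
    have Af: "A \<in> fmeasurable N" using atom_fmeasurable[OF A(1)] .
    have Npos: "0 < measure N A" using atom_measure_pos[OF A(1)] .
    have mN: "measure N A = m (A - H) - m (A \<inter> H)" using measure_N[OF Af] by (simp add: m_def)
    have sgn: "0 \<le> m (A - H)" "m (A \<inter> H) \<le> 0"
      using parts(1,2)[of A] Af mu_m[OF DH(1)[OF Af]] mu_m[OF DH(2)[OF Af]]
      by (auto simp: fmeasurable_N_iff)
    \<comment> \<open>Condition L compares a set of \<open>mu\<close>-value 0 with the empty
      set.\<close>
    have null: "q B = 0" if "B \<in> fmeasurable N" "m B = 0" for B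
      using q_eq[of B "{}"] mu_m[OF that(1)] that q0 signed_measure_empty[OF mu] by (simp add: zero_ereal_def)
    have "measure N (A \<inter> H) = - m (A \<inter> H)"
    proof -
      have e: "A \<inter> H - H = {}" "A \<inter> H \<inter> H = A \<inter> H" by auto
      show ?thesis using measure_N[OF DH(2)[OF Af], unfolded e] m0 by (simp add: m_def)
    qed
    moreover have "measure N (H \<inter> A) = 0 \<or> measure N (H \<inter> A) = measure N A"
      using atom_Int_cases[OF A(1)] H by simp
    \<comment> \<open>\<open>H\<close> cuts an atom into a null part and a part of full measure, so
      on an atom \<open>mu\<close> and \<open>nu\<close> agree up to sign with the measure and
      \<open>g\<close>.\<close>
    ultimately consider "m (A \<inter> H) = 0" | "m (A - H) = 0" using mN by (auto simp: Int_commute)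
    then have "\<bar>m A\<bar> = measure N A \<and> \<bar>q A\<bar> = \<bar>g A\<bar>"
    proof cases
      case 1
      then show ?thesis
        using null[OF DH(2)[OF Af]] split[OF Af] mN sgn by (simp add: g_def)
    next
      case 2
      then show ?thesis
        using null[OF DH(1)[OF Af]] split[OF Af] mN sgn by (simp add: g_def)
    qed
    then have eq: "\<bar>m A\<bar> = measure N A" "\<bar>q A\<bar> = \<bar>g A\<bar>" by auto
    have "\<bar>nu A / mu A\<bar> < ereal K"
      using eq A mu_m[OF Af] by (intro bound) (auto simp: signed_atom_iff)
    moreover have "m A \<noteq> 0" using eq Npos by auto
    ultimately have "\<bar>q A / m A\<bar> < K" using mu_m[OF Af] nu_q[OF Af] by simp
    then have "\<bar>g A\<bar> / measure N A < K" using eq by (simp add: abs_divide)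
    then show ?thesis using Npos by (simp add: pos_divide_less_eq less_imp_le)
  qed
  then obtain \<alpha> where \<alpha>: "\<And>B. B \<in> fmeasurable N \<Longrightarrow> g B = \<alpha> * measure N B"
    using linear_if_bounded_on_small_atoms[OF \<open>0 < \<epsilon>\<close>] by blast
  have "nu A = ereal (\<alpha> * real_of_ereal (mu A))" if A: "A \<in> fmeasurable N" for A
  proof -
    have e: "A - H - H = A - H" "(A - H) \<inter> H = {}" "A \<inter> H - H = {}" "A \<inter> H \<inter> H = A \<inter> H" by auto
    \<comment> \<open>Passing from \<open>mu\<close>, \<open>nu\<close> to the measure and
      \<open>g\<close> keeps both signs outside \<open>H\<close> and reverses both inside, so the
      same factor governs the two parts.\<close>
    have "q (A - H) = \<alpha> * m (A - H)"
      using \<alpha>[OF DH(1)[OF A]] measure_N[OF DH(1)[OF A]] q0 m0 by (simp add: g_def e flip: m_def)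
    moreover have "q (A \<inter> H) = \<alpha> * m (A \<inter> H)"
      using \<alpha>[OF DH(2)[OF A]] measure_N[OF DH(2)[OF A]] q0 m0 by (simp add: g_def e flip: m_def)
    ultimately have "q A = \<alpha> * m A" using split[OF A] by (simp add: algebra_simps)
    then show ?thesis using nu_q[OF A] by (simp add: m_def)
  qed
  then show ?thesis by blast
qed

end

text \<open>Sets of infinite \<open>mu\<close> are exhausted by sets of finite variation, and
  proportionality passes to the limit. The bound on atoms is phrased with
  \<open>\<bar>mu A\<bar>\<close> so that the lemma can also be applied to
  \<open>- mu\<close>.\<close>

lemma signed_multiple_no_MInf:
  assumes mu: "sigma_finite_signed_measure M mu" and no_MInf: "- \<infinity> \<notin> mu ` sets M"
    and int: "ereal_interval (mu ` sets M)"
    and nu: "signed_measure M nu" and L: "condition_L M mu nu" and "0 < \<epsilon>"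
    and bound: "\<And>A. \<lbrakk>signed_atom M mu A; \<bar>mu A\<bar> < ereal \<epsilon>\<rbrakk> \<Longrightarrow> \<bar>nu A / mu A\<bar> < ereal K"
  shows "\<exists>\<alpha>::real. \<forall>A\<in>sets M. nu A = ereal \<alpha> * mu A"
proof -
  have mu': "signed_measure M mu" using mu by (simp add: sigma_finite_signed_measure_def)
  obtain H where H: "H \<in> sets M" "\<And>B. \<lbrakk>B \<in> sets M; B \<subseteq> H\<rbrakk> \<Longrightarrow> mu B \<le> 0"
    "\<And>B. \<lbrakk>B \<in> sets M; B \<inter> H = {}\<rbrakk> \<Longrightarrow> 0 \<le> mu B"
    using Hahn_decomposition_signed[OF mu' no_MInf] by blast
  interpret Hahn_decomposed M mu H by unfold_locales (fact mu' no_MInf H)+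
  obtain C :: "nat \<Rightarrow> 'a set" where C: "range C \<subseteq> sets M" "(\<Union>i. C i) = space M"
    "\<And>i. total_variation M mu (C i) < \<infinity>"
    using assms(1)[unfolded sigma_finite_signed_measure_def, THEN conjunct2] by (elim exE conjE) auto
  have N: "sigma_finite_measure N" by (rule sigma_finite_N[OF C])
  obtain \<alpha> where \<alpha>: "\<And>A. A \<in> fmeasurable N \<Longrightarrow> nu A = ereal (\<alpha> * real_of_ereal (mu A))"
    using multiple_on_fmeasurable[OF N int nu L \<open>0 < \<epsilon>\<close> bound] by blast
  have "nu A = ereal \<alpha> * mu A" if A: "A \<in> sets M" for A
  proof -
    obtain E :: "nat \<Rightarrow> 'a set" where E: "range E \<subseteq> sets N" "(\<Union>i. E i) = space N"
      "\<And>i. emeasure N (E i) \<noteq> \<infinity>" "disjoint_family E"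
      using sigma_finite_measure.sigma_finite_disjoint[OF N] by metis
    have E_fm: "A \<inter> E i \<in> fmeasurable N" for i
      using fmeasurable_Int_fmeasurable[of "E i" N A] E(1,3) A
      by (auto simp: fmeasurable_def less_top Int_commute)
    have AE: "(\<Union>i. A \<inter> E i) = A" using E(2) sets.sets_into_space[OF A] by auto
    have dis: "disjoint_family (\<lambda>i. A \<inter> E i)"
      by (rule disjoint_family_on_bisimulation[OF E(4)]) auto
    have rng: "range (\<lambda>i. A \<inter> E i) \<subseteq> sets M" using E_fm by (auto simp: fmeasurable_N_iff)
    \<comment> \<open>All terms are finite, so the factor can be pulled out over the reals, away
      from the arithmetic of infinite values.\<close>
    have sums: "(\<Sum>i<n. nu (A \<inter> E i)) = ereal \<alpha> * (\<Sum>i<n. mu (A \<inter> E i))" for n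
    proof -
      have "mu (A \<inter> E i) = ereal (real_of_ereal (mu (A \<inter> E i)))" for i
        using E_fm[of i] by (simp add: fmeasurable_N_iff ereal_real)
      then have "(\<Sum>i<n. mu (A \<inter> E i)) = ereal (\<Sum>i<n. real_of_ereal (mu (A \<inter> E i)))"
        by (metis (no_types, lifting) sum.cong sum_ereal)
      moreover have "(\<Sum>i<n. nu (A \<inter> E i)) = ereal (\<Sum>i<n. \<alpha> * real_of_ereal (mu (A \<inter> E i)))"
        using \<alpha>[OF E_fm] by simp
      ultimately show ?thesis by (simp add: sum_distrib_left)
    qed
    have "(\<lambda>n. ereal \<alpha> * (\<Sum>i<n. mu (A \<inter> E i))) \<longlonglongrightarrow> ereal \<alpha> * mu A"
      using signed_measure_LIMSEQ[OF mu' rng dis] unfolding AE by (intro tendsto_cmult_ereal) auto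
    moreover have "(\<lambda>n. ereal \<alpha> * (\<Sum>i<n. mu (A \<inter> E i))) \<longlonglongrightarrow> nu A"
      using signed_measure_LIMSEQ[OF nu rng dis] unfolding AE sums .
    ultimately show ?thesis by (metis LIMSEQ_unique)
  qed
  then show ?thesis by blast
qed

theorem theorem3p5:
  fixes M :: "'a measure" and mu nu :: "'a set \<Rightarrow> ereal"
  assumes "sigma_finite_signed_measure M mu"
    and "ereal_interval (mu ` sets M)"
    and "sigma_finite_signed_measure M nu"
    and "condition_L M mu nu"
    and "\<exists>\<epsilon>::real. \<epsilon> > 0 \<and> (\<exists>K::real. \<forall>A. signed_atom M mu A \<and> mu A < ereal \<epsilon> \<longrightarrow>
            \<bar>nu A / mu A\<bar> < ereal K)"
  shows "\<exists>\<alpha>::real. \<forall>A \<in> sets M. nu A = ereal \<alpha> * mu A"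
proof -
  obtain \<epsilon> K where "0 < \<epsilon>"
    and bound: "\<And>A. \<lbrakk>signed_atom M mu A; mu A < ereal \<epsilon>\<rbrakk> \<Longrightarrow> \<bar>nu A / mu A\<bar> < ereal K"
    using assms(5) by blast
  have nu: "signed_measure M nu" and mu: "signed_measure M mu"
    using assms(1,3) by (auto simp: sigma_finite_signed_measure_def)
  show ?thesis
  proof (cases "- \<infinity> \<in> mu ` sets M")
    case False
    show ?thesis
    proof (rule signed_multiple_no_MInf[OF assms(1) False assms(2) nu assms(4) \<open>0 < \<epsilon>\<close>])
      fix A assume "signed_atom M mu A" "\<bar>mu A\<bar> < ereal \<epsilon>"
      then show "\<bar>nu A / mu A\<bar> < ereal K" by (intro bound) (cases "mu A"; auto)+
    qed
  next
    case True
    then have no_PInf: "\<infinity> \<notin> mu ` sets M" using mu by (auto simp: signed_measure_def)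
    have tv: "total_variation M (\<lambda>A. - mu A) = total_variation M mu"
      by (simp add: total_variation_def fun_eq_iff)
    have "\<exists>\<alpha>::real. \<forall>A\<in>sets M. nu A = ereal \<alpha> * - mu A"
    proof (rule signed_multiple_no_MInf[OF _ _ _ nu _ \<open>0 < \<epsilon>\<close>])
      show "sigma_finite_signed_measure M (\<lambda>A. - mu A)"
        using assms(1) signed_measure_uminus[OF mu] by (simp add: sigma_finite_signed_measure_def tv)
      show "- \<infinity> \<notin> (\<lambda>A. - mu A) ` sets M"
      proof
        assume "- \<infinity> \<in> (\<lambda>A. - mu A) ` sets M"
        then obtain A where "A \<in> sets M" "- \<infinity> = - mu A" by blast
        then show False using no_PInf by (metis ereal_uminus_uminus image_eqI)
      qed
      show "ereal_interval ((\<lambda>A. - mu A) ` sets M)"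
        unfolding ereal_interval_def
      proof (intro ballI allI impI)
        fix x z y assume "x \<in> (\<lambda>A. - mu A) ` sets M" "z \<in> (\<lambda>A. - mu A) ` sets M" and y: "x \<le> y \<and> y \<le> z"
        then obtain A B where "A \<in> sets M" "B \<in> sets M" "x = - mu A" "z = - mu B" by blast
        then have "mu A \<in> mu ` sets M" "mu B \<in> mu ` sets M" "mu B \<le> - y" "- y \<le> mu A"
          using y ereal_minus_le_minus[of "- mu B" y] ereal_minus_le_minus[of y "- mu A"] by auto
        then have "- y \<in> mu ` sets M" using assms(2) unfolding ereal_interval_def by blast
        then obtain C where "C \<in> sets M" "- y = mu C" by blast
        then show "y \<in> (\<lambda>A. - mu A) ` sets M" by (metis ereal_uminus_uminus image_eqI)
      qed
      show "condition_L M (\<lambda>A. - mu A) nu"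
        using assms(4) by (simp add: condition_L_def)
      fix A assume A: "signed_atom M (\<lambda>A. - mu A) A" "\<bar>- mu A\<bar> < ereal \<epsilon>"
      then have "signed_atom M mu A" by (simp add: signed_atom_def tv)
      moreover have "mu A < ereal \<epsilon>" using A(2) by (cases "mu A") auto
      ultimately have "\<bar>nu A / mu A\<bar> < ereal K" by (rule bound)
      \<comment> \<open>Division by 0 in \<open>ereal\<close> does not see the sign of 0; for
        nonzero \<open>mu A\<close> the absolute value removes the sign.\<close>
      then show "\<bar>nu A / - mu A\<bar> < ereal K"
        by (cases "mu A = 0") (simp_all add: divide_ereal_def)
    qed
    then obtain \<alpha> :: real where "\<And>A. A \<in> sets M \<Longrightarrow> nu A = ereal \<alpha> * - mu A" by blast
    then have "\<forall>A\<in>sets M. nu A = ereal (- \<alpha>) * mu A" by (simp flip: uminus_ereal.simps(1))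
    then show ?thesis by blast
  qed
qed

end
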